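(* Let $h=0$, $\mu>0$ and $\rho=\frac1{2\mu}$. Then for all $\beta<\frac{2\mu}J$, \[ w_2(\mu_{\mathrm{GC}}^{\beta,\mu;N},\mu_{\mathrm{MC}}^{0,\rho;N};N)^2\le\frac1N\frac1{2(\mu-\frac{\beta J}2)}+\frac1N\frac1\mu=\frac1N\left(\frac\rho{1-\rho\beta J}+2\rho\right), \] so that $w_2(\mu_{\mathrm{GC}}^{\beta,\mu;N},\mu_{\mathrm{MC}}^{0,\rho;N};N)=O(N^{-1/2})$.
   Context: Mean-field spherical model with $h=0$: $\phi\in\mathbb{R}^N$, $J>0$, $H[\phi]=-\frac J{2N}(\sum_x\phi_x)^2$, $N[\phi]=\sum_x\phi_x^2$. The grand canonical ensemble $\mu_{\mathrm{GC}}^{\beta,\mu;N}$ ($\mu>0$, $\beta<2\mu/J$) is the probability measure on $\mathbb{R}^N$ with density proportional to $e^{-\beta H[\phi]-\mu N[\phi]}$. The microcanonical ensemble at energy density $0$, $\mu_{\mathrm{MC}}^{0,\rho;N}$, is the normalized uniform surface measure on $\{\sum_x\phi_x=0,\ \sum_x\phi_x^2=\rho N\}$. $w_2(\mu_1,\mu_2;N)=\left(\inf_\gamma\int\gamma(dx,dy)\frac1N\sum_i|x_i-y_i|^2\right)^{1/2}$ over couplings. *)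

theory Defs
  imports "HOL-Analysis.Analysis" "HOL-Probability.Probability"
begin

text \<open>Configurations \<open>\<phi> \<in> \<real>^N\<close> are modelled as \<open>real ^ 'n\<close> with \<open>N = CARD('n)\<close>.\<close>

definition total_spin :: "real ^ 'n \<Rightarrow> real" where
  "total_spin \<phi> = (\<Sum>x\<in>UNIV. \<phi> $ x)"

definition particle_number :: "real ^ 'n \<Rightarrow> real" where
  "particle_number \<phi> = (\<Sum>x\<in>UNIV. (\<phi> $ x)^2)"

text \<open>Mean-field Hamiltonian with h = 0.\<close>
definition mf_hamiltonian :: "real \<Rightarrow> real ^ 'n \<Rightarrow> real" where
  "mf_hamiltonian J \<phi> = - J / (2 * real CARD('n)) * (total_spin \<phi>)^2"

definition gc_weight :: "real \<Rightarrow> real \<Rightarrow> real \<Rightarrow> real ^ 'n \<Rightarrow> real" where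
  "gc_weight J \<beta> \<mu> \<phi> = exp (- \<beta> * mf_hamiltonian J \<phi> - \<mu> * particle_number \<phi>)"

definition gc_ensemble :: "real \<Rightarrow> real \<Rightarrow> real \<Rightarrow> (real ^ 'n) measure" where
  "gc_ensemble J \<beta> \<mu> = density lborel
     (\<lambda>\<phi>. ennreal (gc_weight J \<beta> \<mu> \<phi> / (\<integral>\<psi>. gc_weight J \<beta> \<mu> (\<psi> :: real ^ 'n) \<partial>lborel)))"

text \<open>k-dimensional Hausdorff (outer) measure, up to the irrelevant normalising constant
  (which cancels in the normalised surface measure). Covers by countably many bounded sets.\<close>
definition hausdorff_delta :: "nat \<Rightarrow> real \<Rightarrow> 'a::metric_space set \<Rightarrow> ennreal" where
  "hausdorff_delta k \<delta> A =
     (INF C\<in>{C :: nat \<Rightarrow> 'a set. A \<subseteq> (\<Union>i. C i) \<and> (\<forall>i. bounded (C i) \<and> diameter (C i) \<le> \<delta>)}.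
        (\<Sum>i. ennreal (if C i = {} then 0 else diameter (C i) ^ k)))"

definition hausdorff :: "nat \<Rightarrow> 'a::metric_space set \<Rightarrow> ennreal" where
  "hausdorff k A = (SUP \<delta>\<in>{0<..}. hausdorff_delta k \<delta> A)"

text \<open>Microcanonical shell at energy density 0 (sum phi = 0) and particle density rho.\<close>
definition mc_shell :: "real \<Rightarrow> (real ^ 'n) set" where
  "mc_shell \<rho> = {\<phi>. total_spin \<phi> = 0 \<and> particle_number \<phi> = \<rho> * real CARD('n)}"

text \<open>Normalised uniform surface measure on the shell, which is an (N-2)-dimensional sphere.\<close>
definition mc_ensemble :: "real \<Rightarrow> (real ^ 'n) measure" where
  "mc_ensemble \<rho> = measure_of UNIV (sets borel)
     (\<lambda>A. hausdorff (CARD('n) - 2) (A \<inter> (mc_shell \<rho> :: (real ^ 'n) set)) / hausdorff (CARD('n) - 2) (mc_shell \<rho> :: (real ^ 'n) set))"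

definition couplings :: "(real ^ 'n) measure \<Rightarrow> (real ^ 'n) measure \<Rightarrow> ((real ^ 'n) \<times> (real ^ 'n)) measure set" where
  "couplings \<mu>1 \<mu>2 = {\<gamma>. sets \<gamma> = sets borel \<and> prob_space \<gamma> \<and>
      distr \<gamma> borel fst = \<mu>1 \<and> distr \<gamma> borel snd = \<mu>2}"

definition w2_sq :: "(real ^ 'n) measure \<Rightarrow> (real ^ 'n) measure \<Rightarrow> ennreal" where
  "w2_sq \<mu>1 \<mu>2 = (INF \<gamma>\<in>couplings \<mu>1 \<mu>2.
      \<integral>\<^sup>+ p. ennreal ((1 / real CARD('n)) * (\<Sum>i\<in>UNIV. \<bar>fst p $ i - snd p $ i\<bar>^2)) \<partial>\<gamma>)"

end

(*
  Let u be the unit vector proportional to (1,...,1), and write phi = s u + psi with psi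
  orthogonal to u. Under the grand canonical measure s and psi are independent Gaussians with
  variances 1/(2(mu - beta J/2)) and rho per dimension. The coupling sends phi to the radial
  projection a psi/|psi| of psi onto the shell, where a^2 = rho N. The cost is
  s^2 + (|psi| - a)^2 <= s^2 + (|psi|^2 - a^2)^2/a^2, and the mean of the last term is
  (2(N-1) + 1) rho^2/(rho N) <= 2 rho = 1/mu.

  The law of the projection is the microcanonical measure because two probability measures on a
  sphere that give equal mass to all balls of equal radius centred on it must coincide.
  For normalised Hausdorff measure this needs 0 < H(shell) < infinity: coverings by grid cells
  give the upper bound; packings bound the ball masses of the projected Gaussian, hence H from
  below.
*)

theory Submission
  imports Defs
begin

section \<open>Hausdorff outer measure\<close>

text \<open>The sphere enters only through one symmetry: reflections that fix u carry any point of
  the shell to any other. Neither polar coordinates nor an area formula is used.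
  \<open>mc_ensemble\<close> is a raw quotient of outer measure values. Before it can be compared
  with anything, the Hausdorff outer measure has to be countably additive on Borel sets, and the
  quotient must not degenerate to 0/0 or to a division by infinity. The projected Gaussian does
  double duty. Its equal ball masses follow from symmetry alone, so it can serve as the test measure
  for the lower bound on H(shell) without circularity; only then is it identified with the
  microcanonical measure. The cost passes from |psi| to |psi|^2 because the moments are then
  polynomial. |psi|^2 is a sum of N-1 independent terms of mean rho and variance 2 rho^2. Its mean
  misses a^2 = rho N by rho, and this bias is the summand 1 in 2(N-1) + 1. For N = 2 the shell is a
  pair of points and the Hausdorff dimension is 0, so all estimates must also hold with 0^0 =
  1.\<close>

abbreviation hausdorff_weight :: "nat \<Rightarrow> 'a::metric_space set \<Rightarrow> ennreal" where
  "hausdorff_weight k C \<equiv> ennreal (if C = {} then 0 else diameter C ^ k)"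

lemma hausdorff_delta_le:
  assumes "A \<subseteq> (\<Union>i. C i)" "\<And>i. bounded (C i)" "\<And>i. diameter (C i) \<le> \<delta>"
  shows "hausdorff_delta k \<delta> A \<le> (\<Sum>i. hausdorff_weight k (C i))"
  unfolding hausdorff_delta_def using assms by (intro INF_lower) auto

lemma hausdorff_delta_less_iff:
  "hausdorff_delta k \<delta> A < c \<longleftrightarrow>
    (\<exists>C. A \<subseteq> (\<Union>i. C i) \<and> (\<forall>i. bounded (C i) \<and> diameter (C i) \<le> \<delta>) \<and>
         (\<Sum>i. hausdorff_weight k (C i)) < c)"
  unfolding hausdorff_delta_def INF_less_iff by auto

lemma hausdorff_delta_mono: "A \<subseteq> B \<Longrightarrow> hausdorff_delta k \<delta> A \<le> hausdorff_delta k \<delta> B"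
  unfolding hausdorff_delta_def by (intro INF_superset_mono) auto

lemma hausdorff_delta_antimono: "\<delta> \<le> \<delta>' \<Longrightarrow> hausdorff_delta k \<delta>' A \<le> hausdorff_delta k \<delta> A"
  unfolding hausdorff_delta_def by (intro INF_superset_mono) (auto intro: order_trans)

lemma hausdorff_delta_empty:
  assumes "0 \<le> \<delta>" shows "hausdorff_delta k \<delta> {} = 0"
  using hausdorff_delta_le[of "{}" "\<lambda>_. {}" \<delta> k] assms by (simp add: diameter_empty)

lemma hausdorff_delta_UN_le:
  fixes A :: "nat \<Rightarrow> 'a::metric_space set"
  shows "hausdorff_delta k \<delta> (\<Union>n. A n) \<le> (\<Sum>n. hausdorff_delta k \<delta> (A n))"
proof (cases "(\<Sum>n. hausdorff_delta k \<delta> (A n)) < top")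
  case True
  show ?thesis
  proof (rule ennreal_le_epsilon)
    fix e :: real assume "0 < e"
    \<comment> \<open>This strict inequality yields a near-optimal cover of each \<open>A n\<close>.
      It fails for infinite values, which is why that case is split off.\<close>
    have "hausdorff_delta k \<delta> (A n) < hausdorff_delta k \<delta> (A n) + ennreal (e * (1/2) ^ Suc n)" for n
    proof -
      have "hausdorff_delta k \<delta> (A n) < top"
        using True ennreal_suminf_lessD by blast
      moreover have "ennreal (e * (1/2) ^ Suc n) > 0" using \<open>0 < e\<close> by (simp del: power_Suc)
      ultimately show ?thesis by (simp add: less_top[symmetric] del: power_Suc)
    qed
    then have "\<forall>n. \<exists>C. A n \<subseteq> (\<Union>i. C i) \<and> (\<forall>i. bounded (C i) \<and> diameter (C i) \<le> \<delta>) \<and>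
         (\<Sum>i. hausdorff_weight k (C i)) < hausdorff_delta k \<delta> (A n) + ennreal (e * (1/2) ^ Suc n)"
      unfolding hausdorff_delta_less_iff by blast
    then obtain C where *: "\<forall>n. A n \<subseteq> (\<Union>i. C n i) \<and> (\<forall>i. bounded (C n i) \<and> diameter (C n i) \<le> \<delta>) \<and>
         (\<Sum>i. hausdorff_weight k (C n i)) < hausdorff_delta k \<delta> (A n) + ennreal (e * (1/2) ^ Suc n)"
      by (rule choice[THEN exE])
    then have C: "\<And>n. A n \<subseteq> (\<Union>i. C n i)"
      "\<And>n i. bounded (C n i)" "\<And>n i. diameter (C n i) \<le> \<delta>"
      "\<And>n. (\<Sum>i. hausdorff_weight k (C n i)) < hausdorff_delta k \<delta> (A n) + ennreal (e * (1/2) ^ Suc n)"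
      by simp_all
    define D where "D = (\<lambda>m. case_prod C (prod_decode m))"
    have "(\<Union>n. A n) \<subseteq> (\<Union>m. D m)"
    proof
      fix x assume "x \<in> (\<Union>n. A n)"
      then obtain n i where "x \<in> C n i" using C(1) by blast
      then have "x \<in> D (prod_encode (n, i))" by (simp add: D_def)
      then show "x \<in> (\<Union>m. D m)" by blast
    qed
    then have "hausdorff_delta k \<delta> (\<Union>n. A n) \<le> (\<Sum>m. hausdorff_weight k (D m))"
      by (rule hausdorff_delta_le) (simp_all add: D_def C(2,3) case_prod_unfold)
    also have "\<dots> = (\<Sum>n. \<Sum>i. hausdorff_weight k (C n i))"
      unfolding D_def by (rule suminf_ennreal_2dimen[where f = "\<lambda>p. hausdorff_weight k (case_prod C p)"]) (simp only: case_prod_conv)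
    also have "\<dots> \<le> (\<Sum>n. hausdorff_delta k \<delta> (A n) + ennreal (e * (1/2) ^ Suc n))"
      by (rule suminf_le[OF less_imp_le[OF C(4)]]) auto
    also have "\<dots> = (\<Sum>n. hausdorff_delta k \<delta> (A n)) + (\<Sum>n. ennreal (e * (1/2) ^ Suc n))"
      by (intro suminf_add[symmetric]) auto
    also have "(\<Sum>n. ennreal (e * (1/2) ^ Suc n)) = ennreal e"
      using sums_mult[OF power_half_series, of e] \<open>0 < e\<close> by (intro suminf_ennreal_eq) auto
    finally show "hausdorff_delta k \<delta> (\<Union>n. A n) \<le> (\<Sum>n. hausdorff_delta k \<delta> (A n)) + ennreal e" .
  qed
next
  case False
  then have "(\<Sum>n. hausdorff_delta k \<delta> (A n)) = top" by (metis less_top)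
  then show ?thesis by simp
qed

lemma hausdorff_delta_le_hausdorff: "0 < \<delta> \<Longrightarrow> hausdorff_delta k \<delta> A \<le> hausdorff k A"
  unfolding hausdorff_def by (intro SUP_upper) auto

lemma hausdorff_least: "(\<And>\<delta>. 0 < \<delta> \<Longrightarrow> hausdorff_delta k \<delta> A \<le> c) \<Longrightarrow> hausdorff k A \<le> c"
  unfolding hausdorff_def by (intro SUP_least) auto

lemma hausdorff_mono: "A \<subseteq> B \<Longrightarrow> hausdorff k A \<le> hausdorff k B"
  by (intro hausdorff_least) (meson hausdorff_delta_le_hausdorff hausdorff_delta_mono order_trans)

lemma hausdorff_empty: "hausdorff k {} = 0"
  using hausdorff_least[of k "{}" 0] by (simp add: hausdorff_delta_empty)

lemma hausdorff_UN_le: "hausdorff k (\<Union>n. A n) \<le> (\<Sum>n. hausdorff k (A n))"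
proof (rule hausdorff_least)
  fix \<delta> :: real assume "0 < \<delta>"
  have "hausdorff_delta k \<delta> (\<Union>n. A n) \<le> (\<Sum>n. hausdorff_delta k \<delta> (A n))"
    by (rule hausdorff_delta_UN_le)
  also have "\<dots> \<le> (\<Sum>n. hausdorff k (A n))"
    by (intro suminf_le hausdorff_delta_le_hausdorff \<open>0 < \<delta>\<close>) auto
  finally show "hausdorff_delta k \<delta> (\<Union>n. A n) \<le> (\<Sum>n. hausdorff k (A n))" .
qed

lemma outer_measure_space_hausdorff: "outer_measure_space UNIV (hausdorff k)"
  unfolding outer_measure_space_def positive_def increasing_def countably_subadditive_def
  by (auto simp: hausdorff_empty hausdorff_mono hausdorff_UN_le)

lemma hausdorff_Un_le: "hausdorff k (A \<union> B) \<le> hausdorff k A + hausdorff k B"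
proof -
  have "hausdorff k (\<Union>n. if n = 0 then A else if n = Suc 0 then B else {})
      \<le> (\<Sum>n. hausdorff k (if n = 0 then A else if n = Suc 0 then B else {}))"
    by (rule hausdorff_UN_le)
  also have "\<dots> = (\<Sum>n<2. hausdorff k (if n = 0 then A else if n = Suc 0 then B else {}))"
    by (rule suminf_finite) (auto simp: hausdorff_empty)
  also have "\<dots> = hausdorff k A + hausdorff k B" by (simp add: numeral_2_eq_2)
  also have "(\<Union>n. if n = 0 then A else if n = Suc 0 then B else {}) = A \<union> B"
    by (auto split: if_splits)
  finally show ?thesis .
qed

text \<open>A covering set of diameter below \<open>\<eta>\<close> cannot meet both \<open>A\<close>
  and \<open>B\<close>, so every sufficiently fine cover of the union splits into a cover of
  each.\<close>

lemma hausdorff_separated_ge: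
  fixes A B :: "'a::metric_space set"
  assumes "0 < \<eta>" and sep: "\<And>x y. x \<in> A \<Longrightarrow> y \<in> B \<Longrightarrow> \<eta> \<le> dist x y"
  shows "hausdorff k A + hausdorff k B \<le> hausdorff k (A \<union> B)"
proof -
  have delta: "hausdorff_delta k \<delta> A + hausdorff_delta k \<delta> B \<le> hausdorff_delta k \<delta> (A \<union> B)"
    if "0 < \<delta>" "\<delta> < \<eta>" for \<delta>
    unfolding hausdorff_delta_def[of k \<delta> "A \<union> B"]
  proof (rule INF_greatest, clarify)
    fix C :: "nat \<Rightarrow> 'a set"
    assume C: "A \<union> B \<subseteq> (\<Union>i. C i)" "\<forall>i. bounded (C i) \<and> diameter (C i) \<le> \<delta>"
    define CA where "CA = (\<lambda>i. if C i \<inter> A = {} then {} else C i)"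
    define CB where "CB = (\<lambda>i. if C i \<inter> B = {} then {} else C i)"
    have disj: "C i \<inter> A = {} \<or> C i \<inter> B = {}" for i
    proof (rule ccontr)
      assume "\<not> ?thesis"
      then obtain x y where "x \<in> C i" "x \<in> A" "y \<in> C i" "y \<in> B" by blast
      then have "dist x y \<le> \<delta>" using C(2) diameter_bounded_bound[of "C i" x y] by (meson order_trans)
      then show False using sep[of x y] \<open>x \<in> A\<close> \<open>y \<in> B\<close> that by auto
    qed
    have "hausdorff_delta k \<delta> A \<le> (\<Sum>i. hausdorff_weight k (CA i))"
      using C that by (intro hausdorff_delta_le) (auto simp: CA_def diameter_empty, blast)
    moreover have "hausdorff_delta k \<delta> B \<le> (\<Sum>i. hausdorff_weight k (CB i))"
      using C that by (intro hausdorff_delta_le) (auto simp: CB_def diameter_empty, blast)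
    ultimately have "hausdorff_delta k \<delta> A + hausdorff_delta k \<delta> B
        \<le> (\<Sum>i. hausdorff_weight k (CA i)) + (\<Sum>i. hausdorff_weight k (CB i))"
      by (rule add_mono)
    also have "\<dots> = (\<Sum>i. hausdorff_weight k (CA i) + hausdorff_weight k (CB i))"
      by (intro suminf_add) auto
    also have "\<dots> \<le> (\<Sum>i. hausdorff_weight k (C i))"
      using disj by (intro suminf_le) (auto simp: CA_def CB_def)
    finally show "hausdorff_delta k \<delta> A + hausdorff_delta k \<delta> B \<le> (\<Sum>i. hausdorff_weight k (C i))" .
  qed
  \<comment> \<open>The two suprema run over independent scales; refining both to a common scale
    below \<open>\<eta>\<close> only increases the left-hand side.\<close>
  have "hausdorff_delta k \<delta>1 A + hausdorff_delta k \<delta>2 B \<le> hausdorff k (A \<union> B)"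
    if "0 < \<delta>1" "0 < \<delta>2" for \<delta>1 \<delta>2
  proof -
    define \<delta> where "\<delta> = min (min \<delta>1 \<delta>2) (\<eta> / 2)"
    have \<delta>: "0 < \<delta>" "\<delta> < \<eta>" "\<delta> \<le> \<delta>1" "\<delta> \<le> \<delta>2" using that \<open>0 < \<eta>\<close> by (auto simp: \<delta>_def)
    have "hausdorff_delta k \<delta>1 A + hausdorff_delta k \<delta>2 B \<le> hausdorff_delta k \<delta> A + hausdorff_delta k \<delta> B"
      using \<delta> by (intro add_mono hausdorff_delta_antimono)
    also have "\<dots> \<le> hausdorff_delta k \<delta> (A \<union> B)" using \<delta> by (intro delta)
    also have "\<dots> \<le> hausdorff k (A \<union> B)" using \<delta> by (intro hausdorff_delta_le_hausdorff)
    finally show ?thesis .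
  qed
  then have *: "hausdorff_delta k \<delta>1 A + hausdorff k B \<le> hausdorff k (A \<union> B)" if "0 < \<delta>1" for \<delta>1
    using that unfolding hausdorff_def[of k B]
    by (subst ennreal_SUP_add_right) (auto intro!: SUP_least)
  then show ?thesis
    unfolding hausdorff_def[of k A]
    by (subst ennreal_SUP_add_left[symmetric]) (auto intro!: SUP_least)
qed

text \<open>Caratheodory's criterion: the shells \<open>D m\<close> around \<open>F\<close> are pairwise separated along
  even and along odd indices, so their total mass is at most \<open>2 H(T)\<close> and its tails vanish.\<close>

lemma hausdorff_closed_ge:
  fixes F T :: "'a::metric_space set"
  assumes "closed F"
  shows "hausdorff k (T \<inter> F) + hausdorff k (T - F) \<le> hausdorff k T"
proof (cases "F = {} \<or> hausdorff k T = top")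
  case True
  then show ?thesis by (auto simp: hausdorff_empty)
next
  case False
  then have F: "F \<noteq> {}" and fin: "hausdorff k T < top" by (auto simp: less_top)
  let ?H = "hausdorff k"
  define A where "A = (\<lambda>n::nat. {x \<in> T. 1 / real (n + 1) \<le> infdist x F})"
  define D where "D = (\<lambda>n. A (Suc n) - A n)"
  have sep: "?H U + ?H V \<le> ?H (U \<union> V)"
    if "a > b" "U \<subseteq> {x. a \<le> infdist x F}" "V \<subseteq> {x. infdist x F \<le> b}" for U V a b
  proof (rule hausdorff_separated_ge[of "a - b"])
    show "a - b \<le> dist x y" if "x \<in> U" "y \<in> V" for x y
      using that \<open>U \<subseteq> _\<close> \<open>V \<subseteq> _\<close> infdist_triangle[of x F y] by fastforce
  qed (use that in auto)
  have A_mono: "A m \<subseteq> A n" if "m \<le> n" for m n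
    using that frac_le[of 1 1 "real (m + 1)" "real (n + 1)"] by (force simp: A_def)
  have AD: "A (Suc n) = A n \<union> D n" for n
    using A_mono[of n "Suc n"] by (auto simp: D_def)
  \<comment> \<open>Used for \<open>p = 0\<close> and \<open>p = 1\<close>. The gap between
    \<open>1 / (2n + p)\<close> and \<open>1 / (2n + p + 1)\<close> separates
    \<open>D (2n + p)\<close> from all earlier shells of the same parity. Starting at
    \<open>n = 1\<close> keeps the subtraction in the index from truncating.\<close>
  have sum_step: "(\<Sum>m<n. ?H (D (2 * m + p))) \<le> ?H (A (2 * n + p - 1))" if "n > 0" for n p
    using that
  proof (induction n rule: nat_induct_non_zero)
    case 1
    then show ?case using AD[of p] by (simp add: hausdorff_mono)
  next
    case (Suc n)
    have "(\<Sum>m<Suc n. ?H (D (2 * m + p))) \<le> ?H (A (2 * n + p - 1)) + ?H (D (2 * n + p))"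
      using Suc by (simp add: add_right_mono)
    also have "\<dots> \<le> ?H (A (2 * n + p - 1) \<union> D (2 * n + p))"
    proof (rule sep)
      show "A (2 * n + p - 1) \<subseteq> {x. 1 / real (2 * n + p) \<le> infdist x F}"
        using Suc by (auto simp: A_def of_nat_diff)
      show "D (2 * n + p) \<subseteq> {x. infdist x F \<le> 1 / real (2 * n + p + 1)}"
        by (auto simp: D_def A_def)
      show "1 / real (2 * n + p + 1) < 1 / real (2 * n + p)"
        using Suc by (intro divide_strict_left_mono) auto
    qed
    also have "\<dots> \<le> ?H (A (2 * Suc n + p - 1))"
      using AD[of "2 * n + p"] A_mono[of "2 * n + p - 1" "Suc (2 * n + p)"]
      by (intro hausdorff_mono) auto
    finally show ?case .
  qed
  have A_le: "?H (A n) \<le> ?H T" for n by (intro hausdorff_mono) (auto simp: A_def)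
  have half: "(\<Sum>m. ?H (D (2 * m + p))) \<le> ?H T" for p
  proof (rule suminf_le_const)
    show "(\<Sum>m<n. ?H (D (2 * m + p))) \<le> ?H T" for n
      using sum_step[of n p] A_le[of "2 * n + p - 1"] by (cases "n = 0") auto
  qed auto
  have "(\<Sum>m. ?H (D m)) \<le> ?H T + ?H T"
  proof (rule suminf_le_const)
    fix n
    have "(\<Sum>m<n. ?H (D m)) \<le> (\<Sum>m<2 * n. ?H (D m))" by (intro sum_mono2) auto
    also have "\<dots> = (\<Sum>m<n. ?H (D (2 * m))) + (\<Sum>m<n. ?H (D (2 * m + 1)))"
      by (induction n) (simp_all add: ac_simps)
    also have "\<dots> \<le> ?H T + ?H T"
      using half[of 0] half[of 1] sum_le_suminf[of "\<lambda>m. ?H (D (2 * m))" "{..<n}"]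
        sum_le_suminf[of "\<lambda>m. ?H (D (2 * m + 1))" "{..<n}"]
      by (intro add_mono) (auto intro: order_trans)
    finally show "(\<Sum>m<n. ?H (D m)) \<le> ?H T + ?H T" .
  qed auto
  then have total: "(\<Sum>m. ?H (D m)) < top" using fin by (auto simp: ennreal_add_less_top intro: le_less_trans)
  show ?thesis
  proof (rule ennreal_le_epsilon)
    fix e :: real assume "0 < e"
    have "(\<lambda>n. \<Sum>m<n. ?H (D m)) \<longlonglongrightarrow> (\<Sum>m. ?H (D m))" by (intro summable_LIMSEQ) auto
    then have "(\<lambda>n. (\<Sum>m. ?H (D m)) - (\<Sum>m<n. ?H (D m))) \<longlonglongrightarrow> (\<Sum>m. ?H (D m)) - (\<Sum>m. ?H (D m))"
      using total by (intro tendsto_diff_ennreal tendsto_const) (auto simp: less_top)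
    moreover have "(\<Sum>m. ?H (D m)) - (\<Sum>m. ?H (D m)) < ennreal e"
      using total \<open>0 < e\<close> by (simp add: less_top[symmetric] ennreal_minus_eq_0 diff_eq_0_iff_ennreal)
    ultimately have "eventually (\<lambda>n. (\<Sum>m. ?H (D m)) - (\<Sum>m<n. ?H (D m)) < ennreal e) sequentially"
      by (rule order_tendstoD)
    then obtain n where "(\<Sum>m. ?H (D m)) - (\<Sum>m<n. ?H (D m)) < ennreal e"
      by (auto simp: eventually_sequentially)
    moreover have "(\<Sum>m. ?H (D m)) = (\<Sum>m. ?H (D (m + n))) + (\<Sum>m<n. ?H (D m))"
      by (intro suminf_offset) auto
    moreover have "(\<Sum>m<n. ?H (D m)) < top"
      by (rule le_less_trans[OF sum_le_suminf total]) auto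
    ultimately have tail: "(\<Sum>m. ?H (D (m + n))) < ennreal e"
      by (simp add: ennreal_add_diff_cancel_right less_top[symmetric])
    have A_n: "A (n + j) \<subseteq> A n \<union> (\<Union>m. D (m + n))" for j
      by (induction j) (auto simp: AD ac_simps)
    have "T - F \<subseteq> A n \<union> (\<Union>m. D (m + n))"
    proof
      fix x assume x: "x \<in> T - F"
      then have "0 < infdist x F" using infdist_pos_not_in_closed[OF assms F] by blast
      then obtain j where j: "1 / real (Suc j) < infdist x F"
        using nat_approx_posE by blast
      then have "x \<in> A j" using x by (auto simp: A_def)
      then have "x \<in> A (n + j)" using A_mono[of j "n + j"] by auto
      then show "x \<in> A n \<union> (\<Union>m. D (m + n))" using A_n by blast
    qed
    then have "?H (T - F) \<le> ?H (A n \<union> (\<Union>m. D (m + n)))" by (rule hausdorff_mono)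
    also have "\<dots> \<le> ?H (A n) + (\<Sum>m. ?H (D (m + n)))"
      by (rule order_trans[OF hausdorff_Un_le add_left_mono[OF hausdorff_UN_le]])
    also have "\<dots> \<le> ?H (A n) + ennreal e" using tail by (intro add_left_mono) auto
    finally have "?H (T \<inter> F) + ?H (T - F) \<le> ?H (A n) + ?H (T \<inter> F) + ennreal e"
      by (metis add.commute add.left_commute add_left_mono)
    also have "?H (A n) + ?H (T \<inter> F) \<le> ?H (A n \<union> (T \<inter> F))"
      by (rule sep[of 0 "1 / real (n + 1)"]) (auto simp: A_def)
    also have "\<dots> \<le> ?H T" by (intro hausdorff_mono) (auto simp: A_def)
    finally show "?H (T \<inter> F) + ?H (T - F) \<le> ?H T + ennreal e" by (simp add: add_right_mono)
  qed
qed

text \<open>By the Caratheodory inequality the closed sets lie in the lambda system, and they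
  generate the Borel sets. Without countable additivity \<open>measure_of\<close> would collapse to
  the zero measure.\<close>

lemma measure_space_hausdorff: "measure_space UNIV (sets borel) (hausdorff k)"
proof -
  interpret P: sigma_algebra UNIV "UNIV :: 'a set set" using sigma_algebra_Pow[of UNIV] by simp
  let ?L = "lambda_system UNIV UNIV (hausdorff k) :: 'a set set"
  have ms: "measure_space UNIV ?L (hausdorff k)"
    by (rule P.caratheodory_lemma) (rule outer_measure_space_hausdorff)
  have "F \<in> ?L" if "closed F" for F :: "'a set"
  proof -
    have "hausdorff k (T \<inter> F) + hausdorff k (T - F) = hausdorff k T" for T
    proof (rule antisym[OF hausdorff_closed_ge[OF that]])
      show "hausdorff k T \<le> hausdorff k (T \<inter> F) + hausdorff k (T - F)"
        using hausdorff_Un_le[of k "T \<inter> F" "T - F"] by (simp add: Int_Diff_Un)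
    qed
    then show ?thesis by (simp add: P.lambda_system_eq)
  qed
  moreover have "sets borel = sigma_sets UNIV (Collect closed :: 'a set set)"
    by (simp add: borel_eq_closed)
  ultimately have "sets borel \<subseteq> ?L"
    using ms unfolding measure_space_def
    by (auto dest!: sigma_algebra.sigma_sets_subset[of UNIV ?L "Collect closed"])
  then show ?thesis
    using ms sets.sigma_algebra_axioms[of borel] by (intro measure_down[OF ms]) auto
qed

section \<open>Hausdorff measure on Borel sets and its behaviour under isometries\<close>

definition hausdorff_measure :: "nat \<Rightarrow> 'a::metric_space measure" where
  "hausdorff_measure k = measure_of UNIV (sets borel) (hausdorff k)"

lemma sets_hausdorff_measure [simp, measurable_cong]: "sets (hausdorff_measure k) = sets borel"
  unfolding hausdorff_measure_def using sets.sigma_sets_eq[of borel] by simp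

lemma space_hausdorff_measure [simp]: "space (hausdorff_measure k) = UNIV"
  by (simp add: hausdorff_measure_def)

lemma emeasure_hausdorff_measure:
  "A \<in> sets borel \<Longrightarrow> emeasure (hausdorff_measure k) A = hausdorff k A"
  using measure_space_hausdorff[of k] unfolding measure_space_def
  by (intro emeasure_measure_of[OF hausdorff_measure_def]) auto

text \<open>An isometry maps covers to covers with the same diameters. This inequality serves
  finiteness directly, and gives equality of ball masses when it is used with the two centres
  exchanged.\<close>

lemma hausdorff_isometric_image_le:
  fixes f :: "'a::metric_space \<Rightarrow> 'b::metric_space"
  assumes iso: "\<And>x y. dist (f x) (f y) = dist x y"
  shows "hausdorff k (f ` A) \<le> hausdorff k A"
proof -
  have diam: "diameter (f ` C) = diameter C" for C
  proof -
    have "f ` C \<times> f ` C = map_prod f f ` (C \<times> C)" by auto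
    then show ?thesis by (simp add: diameter_def image_image iso case_prod_unfold)
  qed
  have "hausdorff_delta k \<delta> (f ` A) \<le> hausdorff_delta k \<delta> A" for \<delta>
    unfolding hausdorff_delta_def[of k \<delta> A]
  proof (rule INF_greatest, clarify)
    fix C :: "nat \<Rightarrow> 'a set"
    assume C: "A \<subseteq> (\<Union>i. C i)" "\<forall>i. bounded (C i) \<and> diameter (C i) \<le> \<delta>"
    have "bounded (f ` C i)" for i
    proof -
      obtain x e where "\<forall>y\<in>C i. dist x y \<le> e" using C(2) unfolding bounded_def by meson
      then show ?thesis unfolding bounded_def by (intro exI[of _ "f x"] exI[of _ e]) (simp add: iso)
    qed
    then have "hausdorff_delta k \<delta> (f ` A) \<le> (\<Sum>i. hausdorff_weight k (f ` C i))"
      using C by (intro hausdorff_delta_le) (fastforce simp: diam)+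
    then show "hausdorff_delta k \<delta> (f ` A) \<le> (\<Sum>i. hausdorff_weight k (C i))"
      by (simp add: diam cong: if_cong)
  qed
  then show ?thesis
    by (intro hausdorff_least) (meson hausdorff_delta_le_hausdorff order_trans)
qed

section \<open>Uniformly distributed measures\<close>

lemma borel_dist_less_restrict:
  fixes V W :: "'a::{metric_space, second_countable_topology} set"
  assumes "sets P = sets borel" "sets Q = sets borel" and [measurable]: "V \<in> sets borel" "W \<in> sets borel"
  shows "{p. fst p \<in> V \<and> dist (fst p) (snd p) < r \<and> snd p \<in> W} \<in> sets (P \<Otimes>\<^sub>M Q)"
proof -
  have "sets (P \<Otimes>\<^sub>M Q) = sets (borel \<Otimes>\<^sub>M borel)"
    by (intro sets_pair_measure_cong assms)
  moreover have "{p. fst p \<in> V \<and> dist (fst p) (snd p) < r \<and> snd p \<in> W} =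
      {p \<in> space (borel \<Otimes>\<^sub>M borel). fst p \<in> V \<and> dist (fst p) (snd p) < r \<and> snd p \<in> W}"
    by (simp add: space_pair_measure)
  moreover have "\<dots> \<in> sets (borel \<Otimes>\<^sub>M borel)" by measurable
  ultimately show ?thesis by simp
qed

text \<open>The section over \<open>x\<close> is a ball around \<open>x\<close>, so for almost every
  \<open>x\<close> in \<open>V\<close> it has the same mass \<open>c\<close>. The constraint
  \<open>snd p \<in> UNIV\<close> gives the set the same shape as in the companion lemma, where the
  second variable is restricted instead.\<close>

lemma emeasure_pair_dist_less_fst:
  fixes P Q :: "'a::{metric_space, second_countable_topology} measure"
  assumes "sigma_finite_measure Q" "sets P = sets borel" "sets Q = sets borel"
    and AE: "AE x in P. x \<in> S" and ball: "\<And>x. x \<in> S \<Longrightarrow> emeasure Q (ball x r) = c"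
    and V: "V \<in> sets borel"
  shows "emeasure (P \<Otimes>\<^sub>M Q) {p. fst p \<in> V \<and> dist (fst p) (snd p) < r \<and> snd p \<in> UNIV} = c * emeasure P V"
proof -
  interpret Q: sigma_finite_measure Q by fact
  have "emeasure (P \<Otimes>\<^sub>M Q) {p. fst p \<in> V \<and> dist (fst p) (snd p) < r \<and> snd p \<in> UNIV}
      = (\<integral>\<^sup>+x. emeasure Q (Pair x -` {p. fst p \<in> V \<and> dist (fst p) (snd p) < r \<and> snd p \<in> UNIV}) \<partial>P)"
    using assms by (intro Q.emeasure_pair_measure_alt borel_dist_less_restrict) auto
  also have "\<dots> = (\<integral>\<^sup>+x. c * indicator V x \<partial>P)"
  proof (rule nn_integral_cong_AE)
    show "AE x in P. emeasure Q (Pair x -` {p. fst p \<in> V \<and> dist (fst p) (snd p) < r \<and> snd p \<in> UNIV})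
        = c * indicator V x"
      using AE
    proof eventually_elim
      case (elim x)
      have "Pair x -` {p. fst p \<in> V \<and> dist (fst p) (snd p) < r \<and> snd p \<in> UNIV}
          = (if x \<in> V then ball x r else {})" by auto
      then show ?case using ball[OF elim] by auto
    qed
  qed
  also have "\<dots> = c * emeasure P V"
    using assms by (simp add: nn_integral_cmult_indicator)
  finally show ?thesis .
qed

lemma emeasure_pair_dist_less_snd:
  fixes P Q :: "'a::{metric_space, second_countable_topology} measure"
  assumes "sigma_finite_measure P" "sigma_finite_measure Q" "sets P = sets borel" "sets Q = sets borel"
    and AE: "AE y in Q. y \<in> S" and ball: "\<And>y. y \<in> S \<Longrightarrow> emeasure P (ball y r) = c"
    and V: "V \<in> sets borel"
  shows "emeasure (P \<Otimes>\<^sub>M Q) {p. fst p \<in> UNIV \<and> dist (fst p) (snd p) < r \<and> snd p \<in> V} = c * emeasure Q V"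
proof -
  interpret P: sigma_finite_measure P by fact
  interpret Q: sigma_finite_measure Q by fact
  interpret PQ: pair_sigma_finite P Q ..
  have "emeasure (P \<Otimes>\<^sub>M Q) {p. fst p \<in> UNIV \<and> dist (fst p) (snd p) < r \<and> snd p \<in> V}
      = (\<integral>\<^sup>+y. emeasure P ((\<lambda>x. (x, y)) -` {p. fst p \<in> UNIV \<and> dist (fst p) (snd p) < r \<and> snd p \<in> V}) \<partial>Q)"
    using assms by (intro PQ.emeasure_pair_measure_alt2 borel_dist_less_restrict) auto
  also have "\<dots> = (\<integral>\<^sup>+y. c * indicator V y \<partial>Q)"
  proof (rule nn_integral_cong_AE)
    show "AE y in Q. emeasure P ((\<lambda>x. (x, y)) -` {p. fst p \<in> UNIV \<and> dist (fst p) (snd p) < r \<and> snd p \<in> V})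
        = c * indicator V y"
      using AE
    proof eventually_elim
      case (elim y)
      have "(\<lambda>x. (x, y)) -` {p. fst p \<in> UNIV \<and> dist (fst p) (snd p) < r \<and> snd p \<in> V}
          = (if y \<in> V then ball y r else {})" by (auto simp: dist_commute)
      then show ?case using ball[OF elim] by auto
    qed
  qed
  also have "\<dots> = c * emeasure Q V"
    using assms by (simp add: nn_integral_cmult_indicator)
  finally show ?thesis .
qed

text \<open>Christensen's argument: the \<open>P \<times> Q\<close>-mass of \<open>{(x, y). dist x y < r}\<close> is computed in
  both orders, with \<open>x\<close> restricted to points at distance at least \<open>r\<close> from the complement
  of \<open>U\<close>.\<close>

lemma emeasure_open_le_of_ball_eq:
  fixes P Q :: "'a::{metric_space, second_countable_topology} measure"
  assumes sf: "sigma_finite_measure P" "sigma_finite_measure Q"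
    and sets: "sets P = sets borel" "sets Q = sets borel"
    and AE: "AE x in P. x \<in> S" "AE x in Q. x \<in> S"
    and ball: "\<And>x r. x \<in> S \<Longrightarrow> 0 < r \<Longrightarrow> emeasure P (ball x r) = h r"
      "\<And>x r. x \<in> S \<Longrightarrow> 0 < r \<Longrightarrow> emeasure Q (ball x r) = h r"
    and h: "\<And>r. 0 < r \<Longrightarrow> 0 < h r" "\<And>r. 0 < r \<Longrightarrow> h r < top"
    and "open U"
  shows "emeasure P U \<le> emeasure Q U"
proof -
  define V where "V = (\<lambda>n::nat. {x. ball x (1 / real (Suc n)) \<subseteq> U})"
  have V_meas: "V n \<in> sets borel" for n
  proof -
    have "- V n = (\<Union>y\<in>-U. ball y (1 / real (Suc n)))"
      by (auto simp: V_def dist_commute)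
    then have "closed (V n)" unfolding closed_def by auto
    then show ?thesis by (rule borel_closed)
  qed
  have V_le: "emeasure P (V n) \<le> emeasure Q U" for n
  proof -
    let ?r = "1 / real (Suc n)"
    have r: "0 < ?r" by simp
    have "h ?r * emeasure P (V n) =
        emeasure (P \<Otimes>\<^sub>M Q) {p. fst p \<in> V n \<and> dist (fst p) (snd p) < ?r \<and> snd p \<in> UNIV}"
      by (rule emeasure_pair_dist_less_fst[OF sf(2) sets AE(1) ball(2)[OF _ r] V_meas, symmetric])
    \<comment> \<open>A point within distance \<open>r\<close> of \<open>V n\<close> lies in
      \<open>U\<close>. This inclusion moves the restriction from the first variable to the
      second.\<close>
    also have "\<dots> \<le> emeasure (P \<Otimes>\<^sub>M Q) {p. fst p \<in> UNIV \<and> dist (fst p) (snd p) < ?r \<and> snd p \<in> U}"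
      using \<open>open U\<close> by (intro emeasure_mono borel_dist_less_restrict sets) (auto simp: V_def subset_iff)
    also have "\<dots> = h ?r * emeasure Q U"
      by (rule emeasure_pair_dist_less_snd[OF sf sets AE(2) ball(1)[OF _ r] borel_open[OF \<open>open U\<close>]])
    finally show ?thesis
      using h(1)[OF r] h(2)[OF r] by (simp add: ennreal_mult_le_mult_iff less_top)
  qed
  have V_inc: "incseq V"
  proof (rule incseq_SucI)
    show "V n \<le> V (Suc n)" for n
    proof
      fix x assume "x \<in> V n"
      moreover have "ball x (1 / real (Suc (Suc n))) \<subseteq> ball x (1 / real (Suc n))"
        by (intro subset_ball frac_le) auto
      ultimately show "x \<in> V (Suc n)" unfolding V_def by blast
    qed
  qed
  have "U = (\<Union>n. V n)"
  proof safe
    fix x assume "x \<in> U"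
    then obtain e where "0 < e" "ball x e \<subseteq> U" using \<open>open U\<close> openE by blast
    moreover obtain n where "1 / real (Suc n) < e" using nat_approx_posE[OF \<open>0 < e\<close>] by blast
    ultimately have "x \<in> V n" using subset_ball[of "1 / real (Suc n)" e x] by (auto simp: V_def)
    then show "x \<in> (\<Union>n. V n)" by blast
  next
    fix x n assume "x \<in> V n"
    then have "ball x (1 / real (Suc n)) \<subseteq> U" by (simp add: V_def)
    then show "x \<in> U" by (rule subsetD) (simp only: centre_in_ball, simp)
  qed
  moreover have "range V \<subseteq> sets P" using V_meas sets by auto
  ultimately have "emeasure P U = (SUP n. emeasure P (V n))"
    using SUP_emeasure_incseq[of V P] V_inc by simp
  also have "\<dots> \<le> emeasure Q U" by (intro SUP_least V_le)
  finally show ?thesis .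
qed

text \<open>The hypotheses are symmetric in \<open>P\<close> and \<open>Q\<close>, so the inequality
  for open sets holds both ways. Open sets are stable under intersection, and the balls around a
  point of \<open>S\<close> exhaust the space with finite masses.\<close>

lemma measure_eq_of_ball_eq:
  fixes P Q :: "'a::{metric_space, second_countable_topology} measure"
  assumes "sigma_finite_measure P" "sigma_finite_measure Q"
    and sets: "sets P = sets borel" "sets Q = sets borel"
    and "AE x in P. x \<in> S" "AE x in Q. x \<in> S"
    and ball: "\<And>x r. x \<in> S \<Longrightarrow> 0 < r \<Longrightarrow> emeasure P (ball x r) = h r"
      "\<And>x r. x \<in> S \<Longrightarrow> 0 < r \<Longrightarrow> emeasure Q (ball x r) = h r"
    and h: "\<And>r. 0 < r \<Longrightarrow> 0 < h r" "\<And>r. 0 < r \<Longrightarrow> h r < top"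
    and "S \<noteq> {}"
  shows "P = Q"
proof -
  obtain x0 where x0: "x0 \<in> S" using \<open>S \<noteq> {}\<close> by blast
  show ?thesis
  proof (rule measure_eqI_generator_eq[where E = "{U. open U}" and \<Omega> = UNIV and A = "\<lambda>n. ball x0 (real (Suc n))"])
    show "emeasure P U = emeasure Q U" if "U \<in> {U. open U}" for U
    proof (rule antisym)
      show "emeasure P U \<le> emeasure Q U"
        using that by (intro emeasure_open_le_of_ball_eq[of P Q S h] assms) auto
      show "emeasure Q U \<le> emeasure P U"
        using that by (intro emeasure_open_le_of_ball_eq[of Q P S h] assms) auto
    qed
    show "sets P = sigma_sets UNIV {U. open U}" "sets Q = sigma_sets UNIV {U. open U}"
      by (simp_all add: sets borel_def)
    show "emeasure P (ball x0 (real (Suc n))) \<noteq> \<infinity>" for n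
      using ball(1)[OF x0, of "real (Suc n)"] h(2)[of "real (Suc n)"] by simp
    show "(\<Union>n. ball x0 (real (Suc n))) = UNIV"
    proof safe
      fix x
      obtain n where "dist x0 x < real n" using reals_Archimedean2 by blast
      then show "x \<in> (\<Union>n. ball x0 (real (Suc n)))" by (intro UN_I[of n]) auto
    qed auto
  qed (auto simp: Int_stable_def)
qed

section \<open>Invariance of Lebesgue measure under orthogonal maps\<close>

lemma borel_measurable_orthogonal_transformation:
  fixes f :: "'a::euclidean_space \<Rightarrow> 'a"
  assumes "orthogonal_transformation f" shows "f \<in> borel_measurable borel"
  using assms by (intro borel_measurable_continuous_onI linear_continuous_on
    linear_conv_bounded_linear[THEN iffD1] orthogonal_transformation_linear)

text \<open>Balls pull back to balls of the same radius and hence the same volume, so uniqueness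
  from ball masses applies with \<open>S = UNIV\<close>; no determinant is computed.\<close>

lemma distr_lborel_orthogonal_transformation:
  fixes f :: "'a::euclidean_space \<Rightarrow> 'a"
  assumes "orthogonal_transformation f"
  shows "distr lborel borel f = lborel"
proof -
  have f: "linear f" "\<And>x. norm (f x) = norm x"
    using assms by (auto simp: orthogonal_transformation)
  note [measurable] = borel_measurable_orthogonal_transformation[OF assms]
  have ball: "emeasure (distr lborel borel f) (ball x r) = ennreal (unit_ball_vol DIM('a) * r ^ DIM('a))"
    if "0 < r" for x r
  proof -
    obtain y where y: "f y = x"
      using orthogonal_transformation_surj[OF assms] by (metis surjD)
    have "f -` ball x r = ball y r"
      using f by (auto simp: dist_norm simp flip: y linear_diff[OF f(1)])
    then show ?thesis using that by (simp add: emeasure_distr emeasure_ball)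
  qed
  have "sigma_finite_measure (distr lborel borel f)"
  proof
    define A where "A = range (\<lambda>n. ball (0::'a) (real (Suc n)))"
    have "\<Union>A = UNIV"
    proof safe
      fix x :: 'a
      obtain n where "norm x < real n" using reals_Archimedean2 by blast
      then show "x \<in> \<Union>A" unfolding A_def by (intro UnionI[of "ball 0 (real (Suc n))"]) auto
    qed auto
    moreover have "emeasure (distr lborel borel f) a \<noteq> \<infinity>" if "a \<in> A" for a
      using that ball by (auto simp: A_def simp del: of_nat_Suc)
    ultimately show "\<exists>A. countable A \<and> A \<subseteq> sets (distr lborel borel f) \<and>
        \<Union>A = space (distr lborel borel f) \<and> (\<forall>a\<in>A. emeasure (distr lborel borel f) a \<noteq> \<infinity>)"
      by (intro exI[of _ A]) (auto simp: A_def)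
  qed
  then show ?thesis
    using ball
    by (intro measure_eq_of_ball_eq[where S = UNIV and h = "\<lambda>r. ennreal (unit_ball_vol DIM('a) * r ^ DIM('a))"])
       (auto simp: emeasure_ball sigma_finite_lborel)
qed

text \<open>This is the trace of rotation invariance that determines a measure on a sphere.
  Positivity of the ball masses is not demanded, since it follows from full mass on
  \<open>S\<close>.\<close>

definition uniformly_distributed :: "'a::metric_space set \<Rightarrow> 'a measure \<Rightarrow> bool" where
  "uniformly_distributed S P \<longleftrightarrow> prob_space P \<and> sets P = sets borel \<and> (AE x in P. x \<in> S) \<and>
     (\<forall>x\<in>S. \<forall>y\<in>S. \<forall>r. emeasure P (ball x r) = emeasure P (ball y r))"

text \<open>If one ball of radius \<open>r\<close> were null, all those centred on \<open>S\<close>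
  would be; by Lindelof countably many of them cover \<open>S\<close>, which has full mass.\<close>

lemma uniformly_distributed_ball_pos:
  fixes P :: "'a::{metric_space, second_countable_topology} measure"
  assumes P: "uniformly_distributed S P" and x: "x \<in> S" "0 < r"
  shows "0 < emeasure P (ball x r)"
proof (rule ccontr)
  assume "\<not> 0 < emeasure P (ball x r)"
  then have zero: "emeasure P (ball y r) = 0" if "y \<in> S" for y
    using P that \<open>x \<in> S\<close> unfolding uniformly_distributed_def by (metis not_gr_zero)
  interpret prob_space P using P by (simp add: uniformly_distributed_def)
  have sets: "sets P = sets borel" using P by (simp add: uniformly_distributed_def)
  obtain \<F> where \<F>: "\<F> \<subseteq> (\<lambda>y. ball y r) ` S" "countable \<F>" "\<Union>\<F> = (\<Union>y\<in>S. ball y r)"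
    using Lindelof[of "(\<lambda>y. ball y r) ` S"] by auto
  have "(\<Union>U\<in>\<F>. U) \<in> null_sets P"
    using \<F>(1) by (intro null_sets_UN'[OF \<F>(2)]) (auto simp: null_sets_def zero sets)
  moreover have "S \<subseteq> (\<Union>U\<in>\<F>. U)" using \<F>(3) \<open>0 < r\<close> by auto
  ultimately have "AE x in P. x \<notin> S" by (rule_tac AE_I') auto
  moreover have "AE x in P. x \<in> S" using P by (simp add: uniformly_distributed_def)
  ultimately have "AE x in P. False" by eventually_elim auto
  then show False by simp
qed

text \<open>The ball masses of \<open>P\<close> and \<open>Q\<close> could a priori be different
  functions of \<open>r\<close>. Evaluating the product mass of \<open>{dist < r}\<close> in both
  orders shows that they agree, because both total masses are 1.\<close>

lemma uniformly_distributed_unique: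
  fixes P Q :: "'a::{metric_space, second_countable_topology} measure"
  assumes "uniformly_distributed S P" "uniformly_distributed S Q"
  shows "P = Q"
proof -
  note P = assms(1)[unfolded uniformly_distributed_def] and Q = assms(2)[unfolded uniformly_distributed_def]
  interpret P: prob_space P using P by simp
  interpret Q: prob_space Q using Q by simp
  have space: "space P = UNIV" "space Q = UNIV"
    using P Q by (auto dest!: sets_eq_imp_space_eq)
  have "S \<noteq> {}" using P P.AE_False by auto
  then obtain x0 where x0: "x0 \<in> S" by blast
  have sf: "sigma_finite_measure P" "sigma_finite_measure Q" ..
  have sets: "sets P = sets borel" "sets Q = sets borel" using P Q by blast+
  have AE: "AE x in P. x \<in> S" "AE x in Q. x \<in> S" using P Q by blast+
  have P_ball: "emeasure P (ball x r) = emeasure P (ball x0 r)" if "x \<in> S" for x r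
    using P that x0 by metis
  have Q_ball: "emeasure Q (ball x r) = emeasure Q (ball x0 r)" if "x \<in> S" for x r
    using Q that x0 by metis
  have balls: "emeasure Q (ball x0 r) = emeasure P (ball x0 r)" for r
  proof -
    have "emeasure Q (ball x0 r) * emeasure P UNIV =
        emeasure (P \<Otimes>\<^sub>M Q) {p. fst p \<in> UNIV \<and> dist (fst p) (snd p) < r \<and> snd p \<in> UNIV}"
      by (rule emeasure_pair_dist_less_fst[OF sf(2) sets AE(1) Q_ball, symmetric]) auto
    also have "\<dots> = emeasure P (ball x0 r) * emeasure Q UNIV"
      by (rule emeasure_pair_dist_less_snd[OF sf sets AE(2) P_ball]) auto
    finally show ?thesis
      using P.emeasure_space_1 Q.emeasure_space_1 by (simp add: space)
  qed
  show ?thesis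
  proof (rule measure_eq_of_ball_eq[OF sf sets AE P_ball])
    show "0 < emeasure P (ball x0 r)" if "0 < r" for r
      using uniformly_distributed_ball_pos[OF assms(1) x0 that] .
    show "emeasure Q (ball x r) = emeasure P (ball x0 r)" if "x \<in> S" for x r
      using Q_ball[OF that] balls by simp
    show "emeasure P (ball x0 r) < top" for r
      using P.emeasure_finite by (simp add: less_top[symmetric])
  qed (use \<open>S \<noteq> {}\<close> in auto)
qed

section \<open>Gaussian product measures\<close>

text \<open>\<open>\<sigma> b\<close> is the standard deviation along \<open>b\<close>. A density
  with respect to \<open>lborel\<close>, rather than a product of measures, can be compared directly
  with the rotated \<open>gc_weight\<close>.\<close>

definition gauss_measure :: "('a::euclidean_space \<Rightarrow> real) \<Rightarrow> 'a measure" where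
  "gauss_measure \<sigma> = density lborel (\<lambda>x. ennreal (\<Prod>b\<in>Basis. normal_density 0 (\<sigma> b) (x \<bullet> b)))"

lemma sets_gauss_measure [simp, measurable_cong]: "sets (gauss_measure \<sigma>) = sets borel"
  by (simp add: gauss_measure_def)

lemma space_gauss_measure [simp]: "space (gauss_measure \<sigma>) = UNIV"
  by (simp add: gauss_measure_def)

lemma has_bochner_integral_lborel_prod:
  fixes g :: "'a::euclidean_space \<Rightarrow> real \<Rightarrow> real"
  assumes "\<And>b. b \<in> Basis \<Longrightarrow> integrable lborel (g b)"
  shows "has_bochner_integral lborel (\<lambda>x. \<Prod>b\<in>Basis. g b (x \<bullet> b)) (\<Prod>b\<in>Basis. integral\<^sup>L lborel (g b))"
proof -
  interpret product_sigma_finite "\<lambda>b::'a. lborel :: real measure" ..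
  have [measurable]: "g b \<in> borel_measurable borel" if "b \<in> Basis" for b
    using borel_measurable_integrable[OF assms[OF that]] by simp
  have eq: "(\<Prod>b\<in>Basis. g b ((\<Sum>c\<in>Basis. f c *\<^sub>R c) \<bullet> b)) = (\<Prod>b\<in>Basis. g b (f b))" for f
    by (intro prod.cong refl) simp
  have "integrable (\<Pi>\<^sub>M b\<in>Basis. lborel) (\<lambda>f. \<Prod>b\<in>Basis. g b (f b))"
    using assms by (intro product_integrable_prod) auto
  moreover have "(\<integral>f. (\<Prod>b\<in>Basis. g b (f b)) \<partial>(\<Pi>\<^sub>M b\<in>Basis. lborel)) = (\<Prod>b\<in>Basis. integral\<^sup>L lborel (g b))"
    using assms by (intro product_integral_prod) auto
  ultimately show ?thesis
    by (simp add: has_bochner_integral_iff lborel_eq[where 'a='a] integrable_distr_eq integral_distr eq)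
qed

text \<open>The density is itself a product over coordinates, so each factor absorbs its
  \<open>h b\<close> and Fubini applies: the coordinates are independent.\<close>

lemma has_bochner_integral_gauss_measure_prod:
  fixes h :: "'a::euclidean_space \<Rightarrow> real \<Rightarrow> real"
  assumes h: "\<And>b. b \<in> Basis \<Longrightarrow> has_bochner_integral lborel (\<lambda>x. normal_density 0 (\<sigma> b) x * h b x) (m b)"
    and [measurable]: "\<And>b. b \<in> Basis \<Longrightarrow> h b \<in> borel_measurable borel"
  shows "has_bochner_integral (gauss_measure \<sigma>) (\<lambda>x. \<Prod>b\<in>Basis. h b (x \<bullet> b)) (\<Prod>b\<in>Basis. m b)"
proof -
  have "has_bochner_integral lborel (\<lambda>x. \<Prod>b\<in>Basis. normal_density 0 (\<sigma> b) (x \<bullet> b) * h b (x \<bullet> b))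
      (\<Prod>b\<in>Basis. integral\<^sup>L lborel (\<lambda>x. normal_density 0 (\<sigma> b) x * h b x))"
    using h by (intro has_bochner_integral_lborel_prod) (auto simp: has_bochner_integral_iff)
  also have "(\<Prod>b\<in>Basis. integral\<^sup>L lborel (\<lambda>x. normal_density 0 (\<sigma> b) x * h b x)) = (\<Prod>b\<in>Basis. m b)"
    using h by (intro prod.cong refl) (auto simp: has_bochner_integral_iff)
  finally show ?thesis
    unfolding gauss_measure_def
    by (intro has_bochner_integral_density) (auto simp: prod.distrib intro!: prod_nonneg)
qed

lemma has_bochner_integral_normal_density_1:
  "0 < \<sigma> \<Longrightarrow> has_bochner_integral lborel (normal_density \<mu> \<sigma>) 1"
  by (simp add: has_bochner_integral_iff)

lemma prob_space_gauss_measure: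
  fixes \<sigma> :: "'a::euclidean_space \<Rightarrow> real"
  assumes "\<And>b. b \<in> Basis \<Longrightarrow> 0 < \<sigma> b"
  shows "prob_space (gauss_measure \<sigma>)"
proof
  have "has_bochner_integral (gauss_measure \<sigma>) (\<lambda>x. 1::real) 1"
    using has_bochner_integral_gauss_measure_prod[where h = "\<lambda>_ _. 1" and m = "\<lambda>_. 1" and \<sigma> = \<sigma>] assms
    by (simp add: has_bochner_integral_normal_density_1)
  then have "(\<integral>\<^sup>+x. ennreal 1 \<partial>gauss_measure \<sigma>) = ennreal 1"
    by (intro nn_integral_eq_integral[THEN trans]) (auto simp: has_bochner_integral_iff)
  then show "emeasure (gauss_measure \<sigma>) (space (gauss_measure \<sigma>)) = 1" by simp
qed

section \<open>Gaussian moments up to order four and the variance of a squared radius\<close>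

lemma normal_moment_2:
  "0 < \<sigma> \<Longrightarrow> has_bochner_integral lborel (\<lambda>x. normal_density 0 \<sigma> x * x\<^sup>2) (\<sigma>\<^sup>2)"
  using normal_moment_even[of \<sigma> 0 1] by (simp add: fact_numeral)

lemma normal_moment_4:
  "0 < \<sigma> \<Longrightarrow> has_bochner_integral lborel (\<lambda>x. normal_density 0 \<sigma> x * x ^ 4) (3 * \<sigma> ^ 4)"
  using normal_moment_even[of \<sigma> 0 2] by (simp add: fact_numeral power_divide field_simps flip: power_mult)

text \<open>The variance of a squared Gaussian is \<open>3 * \<sigma> ^ 4 - \<sigma> ^ 4\<close>;
  its factor 2 becomes the 2 in the final term \<open>2 * \<rho>\<close>.\<close>

lemma normal_centred_square:
  assumes "0 < \<sigma>"
  shows "has_bochner_integral lborel (\<lambda>x. normal_density 0 \<sigma> x * (x\<^sup>2 - \<sigma>\<^sup>2)) 0"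
    "has_bochner_integral lborel (\<lambda>x. normal_density 0 \<sigma> x * (x\<^sup>2 - \<sigma>\<^sup>2)\<^sup>2) (2 * \<sigma> ^ 4)"
proof -
  note m = normal_moment_2[OF assms] normal_moment_4[OF assms] has_bochner_integral_normal_density_1[OF assms, of 0]
  have "has_bochner_integral lborel (\<lambda>x. normal_density 0 \<sigma> x * x\<^sup>2 - \<sigma>\<^sup>2 * normal_density 0 \<sigma> x) (\<sigma>\<^sup>2 - \<sigma>\<^sup>2 * 1)"
    by (intro has_bochner_integral_diff has_bochner_integral_mult_right m)
  then show "has_bochner_integral lborel (\<lambda>x. normal_density 0 \<sigma> x * (x\<^sup>2 - \<sigma>\<^sup>2)) 0"
    by (simp add: algebra_simps)
  have "has_bochner_integral lborel (\<lambda>x. normal_density 0 \<sigma> x * x ^ 4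
      - (2 * \<sigma>\<^sup>2) * (normal_density 0 \<sigma> x * x\<^sup>2) + \<sigma> ^ 4 * normal_density 0 \<sigma> x)
      (3 * \<sigma> ^ 4 - (2 * \<sigma>\<^sup>2) * \<sigma>\<^sup>2 + \<sigma> ^ 4 * 1)"
    by (intro has_bochner_integral_diff has_bochner_integral_add has_bochner_integral_mult_right m)
  moreover have eq: "normal_density 0 \<sigma> x * x ^ 4 - (2 * \<sigma>\<^sup>2) * (normal_density 0 \<sigma> x * x\<^sup>2) + \<sigma> ^ 4 * normal_density 0 \<sigma> x
      = normal_density 0 \<sigma> x * (x\<^sup>2 - \<sigma>\<^sup>2)\<^sup>2" for x
    by (simp add: algebra_simps power2_eq_square power4_eq_xxxx)
  moreover have m_eq: "3 * \<sigma> ^ 4 - (2 * \<sigma>\<^sup>2) * \<sigma>\<^sup>2 + \<sigma> ^ 4 * 1 = 2 * \<sigma> ^ 4"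
    by (simp add: power2_eq_square power4_eq_xxxx)
  ultimately show "has_bochner_integral lborel (\<lambda>x. normal_density 0 \<sigma> x * (x\<^sup>2 - \<sigma>\<^sup>2)\<^sup>2) (2 * \<sigma> ^ 4)"
    by (simp only: eq m_eq)
qed

lemma gauss_measure_coordinate:
  fixes \<sigma> :: "'a::euclidean_space \<Rightarrow> real"
  assumes \<sigma>: "\<And>b. b \<in> Basis \<Longrightarrow> 0 < \<sigma> b" and c: "c \<in> Basis" and [measurable]: "p \<in> borel_measurable borel"
    and p: "has_bochner_integral lborel (\<lambda>x. normal_density 0 (\<sigma> c) x * p x) m"
  shows "has_bochner_integral (gauss_measure \<sigma>) (\<lambda>x. p (x \<bullet> c)) m"
proof -
  have "has_bochner_integral (gauss_measure \<sigma>)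
      (\<lambda>x. \<Prod>b\<in>Basis. (\<lambda>b y. if b = c then p y else 1) b (x \<bullet> b)) (\<Prod>b\<in>Basis. if b = c then m else 1)"
    using assms by (intro has_bochner_integral_gauss_measure_prod)
      (auto simp: has_bochner_integral_normal_density_1)
  then show ?thesis using c by (simp add: prod.delta)
qed

lemma gauss_measure_two_coordinates:
  fixes \<sigma> :: "'a::euclidean_space \<Rightarrow> real"
  assumes \<sigma>: "\<And>b. b \<in> Basis \<Longrightarrow> 0 < \<sigma> b" and c: "c \<in> Basis" "d \<in> Basis" "c \<noteq> d"
    and [measurable]: "p \<in> borel_measurable borel" "q \<in> borel_measurable borel"
    and p: "has_bochner_integral lborel (\<lambda>x. normal_density 0 (\<sigma> c) x * p x) m"
    and q: "has_bochner_integral lborel (\<lambda>x. normal_density 0 (\<sigma> d) x * q x) n"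
  shows "has_bochner_integral (gauss_measure \<sigma>) (\<lambda>x. p (x \<bullet> c) * q (x \<bullet> d)) (m * n)"
proof -
  have "has_bochner_integral (gauss_measure \<sigma>)
      (\<lambda>x. \<Prod>b\<in>Basis. (\<lambda>b y. if b = c then p y else if b = d then q y else 1) b (x \<bullet> b))
      (\<Prod>b\<in>Basis. if b = c then m else if b = d then n else 1)"
    using assms by (intro has_bochner_integral_gauss_measure_prod)
      (auto simp: has_bochner_integral_normal_density_1)
  moreover have "(\<Prod>b\<in>Basis. if b = c then g b else if b = d then h b else 1) = g c * h d"
    for g h :: "'a \<Rightarrow> real"
  proof -
    have "(\<Prod>b\<in>Basis. if b = c then g b else if b = d then h b else 1)
        = (\<Prod>b\<in>Basis. (if b = c then g b else 1) * (if b = d then h b else 1))"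
      using c by (intro prod.cong) auto
    then show ?thesis using c by (simp add: prod.distrib prod.delta)
  qed
  ultimately show ?thesis by simp
qed

text \<open>Cross terms vanish because distinct coordinates are independent and the summands are
  centred. The shift \<open>t\<close> is a deterministic bias and adds its square; it will be the
  mismatch between the mean squared radius and the squared radius of the shell.\<close>

lemma gauss_measure_centred_square_sum:
  fixes \<sigma> :: "'a::euclidean_space \<Rightarrow> real"
  assumes \<sigma>: "\<And>b. b \<in> Basis \<Longrightarrow> 0 < \<sigma> b" and D: "D \<subseteq> Basis" "\<And>b. b \<in> D \<Longrightarrow> \<sigma> b = s"
  shows "has_bochner_integral (gauss_measure \<sigma>) (\<lambda>x. ((\<Sum>b\<in>D. (x \<bullet> b)\<^sup>2 - s\<^sup>2) - t)\<^sup>2)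
    (2 * s ^ 4 * real (card D) + t\<^sup>2)"
proof -
  define Y where "Y = (\<lambda>b (x::'a). (x \<bullet> b)\<^sup>2 - s\<^sup>2)"
  have Y1: "has_bochner_integral (gauss_measure \<sigma>) (Y b) 0" if "b \<in> D" for b
    unfolding Y_def using that D normal_centred_square(1)[OF \<sigma>[of b]]
    by (intro gauss_measure_coordinate[where p = "\<lambda>y. y\<^sup>2 - s\<^sup>2"] \<sigma>) auto
  have Y2: "has_bochner_integral (gauss_measure \<sigma>) (\<lambda>x. Y b x * Y c x) (if c = b then 2 * s ^ 4 else 0)"
    if "b \<in> D" "c \<in> D" for b c
  proof (cases "c = b")
    case True
    then show ?thesis
      unfolding Y_def using that D normal_centred_square(2)[OF \<sigma>[of b]]
      by (simp flip: power2_eq_square)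
         (intro gauss_measure_coordinate[where p = "\<lambda>y. (y\<^sup>2 - s\<^sup>2)\<^sup>2"] \<sigma>; auto)
  next
    case False
    have "has_bochner_integral (gauss_measure \<sigma>) (\<lambda>x. Y b x * Y c x) (0 * 0)"
      unfolding Y_def using that D False normal_centred_square(1)[OF \<sigma>[of b]] normal_centred_square(1)[OF \<sigma>[of c]]
      by (intro gauss_measure_two_coordinates[where p = "\<lambda>y. y\<^sup>2 - s\<^sup>2" and q = "\<lambda>y. y\<^sup>2 - s\<^sup>2"] \<sigma>) auto
    then show ?thesis using False by simp
  qed
  interpret prob_space "gauss_measure \<sigma>" using prob_space_gauss_measure \<sigma> .
  have "has_bochner_integral (gauss_measure \<sigma>)
      (\<lambda>x. (\<Sum>b\<in>D. \<Sum>c\<in>D. Y b x * Y c x) - 2 * t * (\<Sum>b\<in>D. Y b x) + t\<^sup>2)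
      ((\<Sum>b\<in>D. \<Sum>c\<in>D. if c = b then 2 * s ^ 4 else 0) - 2 * t * (\<Sum>b\<in>D. 0) + t\<^sup>2)"
  proof (intro has_bochner_integral_add has_bochner_integral_diff has_bochner_integral_mult_right
      has_bochner_integral_sum Y1 Y2)
    show "has_bochner_integral (gauss_measure \<sigma>) (\<lambda>x. t\<^sup>2) (t\<^sup>2)"
      using prob_space by (simp add: has_bochner_integral_iff)
  qed auto
  moreover have "finite D" by (rule finite_subset[OF D(1) finite_Basis])
  ultimately show ?thesis
    by (simp add: Y_def power2_diff sum_product power2_eq_square[of "sum _ _"] algebra_simps)
qed

section \<open>Bounds for the Hausdorff measure of a sphere\<close>

lemma hausdorff_delta_le_finite:
  assumes "finite \<C>" "A \<subseteq> \<Union>\<C>" and \<C>: "\<And>C. C \<in> \<C> \<Longrightarrow> bounded C" "\<And>C. C \<in> \<C> \<Longrightarrow> diameter C \<le> \<epsilon>"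
    and "0 \<le> \<epsilon>" "\<epsilon> \<le> \<delta>"
  shows "hausdorff_delta k \<delta> A \<le> ennreal (real (card \<C>) * \<epsilon> ^ k)"
proof -
  obtain e where e: "bij_betw e {..<card \<C>} \<C>"
    using ex_bij_betw_nat_finite[OF \<open>finite \<C>\<close>] by (auto simp: atLeast0LessThan)
  \<comment> \<open>Padding with empty sets is free: their weight is 0 even for
    \<open>k = 0\<close>, where the power of the diameter would be 1.\<close>
  define C where "C = (\<lambda>i. if i < card \<C> then e i else {})"
  have C_in: "C i \<in> \<C>" if "i < card \<C>" for i
    using that e by (auto simp: C_def bij_betw_def)
  have diam: "diameter (C i) \<le> \<epsilon>" "bounded (C i)" for i
    using \<C> C_in[of i] \<open>0 \<le> \<epsilon>\<close> by (cases "i < card \<C>"; simp add: C_def)+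
  have "\<Union>\<C> \<subseteq> (\<Union>i. C i)"
  proof
    fix x assume "x \<in> \<Union>\<C>"
    then obtain i where "i < card \<C>" "x \<in> e i" using e by (auto simp: bij_betw_def)
    then show "x \<in> (\<Union>i. C i)" by (intro UN_I[of i]) (auto simp: C_def)
  qed
  then have "A \<subseteq> (\<Union>i. C i)" using assms(2) by simp
  then have "hausdorff_delta k \<delta> A \<le> (\<Sum>i. hausdorff_weight k (C i))"
    by (rule hausdorff_delta_le) (use diam order_trans[OF diam(1) \<open>\<epsilon> \<le> \<delta>\<close>] in simp_all)
  also have "\<dots> = (\<Sum>i<card \<C>. hausdorff_weight k (C i))"
    by (intro suminf_finite) (auto simp: C_def)
  also have "\<dots> \<le> (\<Sum>i<card \<C>. ennreal (\<epsilon> ^ k))"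
    using diam \<open>0 \<le> \<epsilon>\<close> by (intro sum_mono ennreal_leI) (auto intro!: power_mono diameter_ge_0)
  also have "\<dots> = ennreal (real (card \<C>) * \<epsilon> ^ k)"
    using \<open>0 \<le> \<epsilon>\<close> by (simp add: ennreal_mult ennreal_of_nat_eq_real_of_nat)
  finally show ?thesis .
qed

text \<open>The powers of \<open>m\<close> cancel: \<open>C * m ^ k\<close> sets of diameter
  \<open>D / m\<close> have total weight at most \<open>C * D ^ k\<close> at every scale.\<close>

lemma hausdorff_finite_of_coverings:
  assumes "0 \<le> C" "0 \<le> D"
    and cover: "\<And>m::nat. 0 < m \<Longrightarrow> \<exists>\<C>. finite \<C> \<and> A \<subseteq> \<Union>\<C> \<and> real (card \<C>) \<le> C * real m ^ k \<and>
      (\<forall>X\<in>\<C>. bounded X \<and> diameter X \<le> D / real m)"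
  shows "hausdorff k A < top"
proof -
  have "hausdorff k A \<le> ennreal (C * D ^ k)"
  proof (rule hausdorff_least)
    fix \<delta> :: real assume "0 < \<delta>"
    obtain m :: nat where "D / \<delta> < real m" using reals_Archimedean2 by blast
    moreover from this have "0 < real m" using \<open>0 < \<delta>\<close> \<open>0 \<le> D\<close> by (smt (verit) divide_nonneg_pos)
    ultimately have m: "0 < m" "D / real m \<le> \<delta>"
      using \<open>0 < \<delta>\<close> by (simp_all add: field_simps)
    obtain \<C> where \<C>: "finite \<C>" "A \<subseteq> \<Union>\<C>" "real (card \<C>) \<le> C * real m ^ k"
      "\<forall>X\<in>\<C>. bounded X \<and> diameter X \<le> D / real m"
      using cover[OF m(1)] by blast
    have "hausdorff_delta k \<delta> A \<le> ennreal (real (card \<C>) * (D / real m) ^ k)"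
      using \<C> m \<open>0 \<le> D\<close> by (intro hausdorff_delta_le_finite) auto
    also have "\<dots> \<le> ennreal (C * real m ^ k * (D / real m) ^ k)"
      using \<C>(3) \<open>0 \<le> D\<close> by (intro ennreal_leI mult_right_mono) auto
    also have "C * real m ^ k * (D / real m) ^ k = C * D ^ k"
      using m(1) by (simp add: power_divide)
    finally show "hausdorff_delta k \<delta> A \<le> ennreal (C * D ^ k)" .
  qed
  then show ?thesis by (rule le_less_trans) simp
qed

text \<open>The balls of radius \<open>r\<close> around the points of \<open>F\<close> are disjoint,
  have equal mass and fit into a probability measure.\<close>

lemma uniformly_distributed_ball_le:
  fixes P :: "'a::{metric_space, second_countable_topology} measure"
  assumes P: "uniformly_distributed S P" and x: "x \<in> S"
    and F: "finite F" "F \<subseteq> S" and sep: "\<And>y z. y \<in> F \<Longrightarrow> z \<in> F \<Longrightarrow> y \<noteq> z \<Longrightarrow> 2 * r \<le> dist y z"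
  shows "measure P (ball x r) * real (card F) \<le> 1"
proof -
  interpret prob_space P using P by (simp add: uniformly_distributed_def)
  have sets: "sets P = sets borel" using P by (simp add: uniformly_distributed_def)
  have "measure P (ball x r) * real (card F) = (\<Sum>y\<in>F. measure P (ball x r))" by simp
  also have "\<dots> = (\<Sum>y\<in>F. measure P (ball y r))"
    using P F x unfolding uniformly_distributed_def measure_def by (intro sum.cong refl) (metis subsetD)
  also have "\<dots> = measure P (\<Union>y\<in>F. ball y r)"
  proof (rule finite_measure_finite_Union[symmetric])
    show "disjoint_family_on (\<lambda>y. ball y r) F"
      unfolding disjoint_family_on_def
    proof (intro ballI impI equals0I)
      fix y z w assume "y \<in> F" "z \<in> F" "y \<noteq> z" "w \<in> ball y r \<inter> ball z r"
      then show False using sep[of y z] dist_triangle2[of y z w] by (auto simp: dist_commute)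
    qed
  qed (use F sets in auto)
  also have "\<dots> \<le> 1" by simp
  finally show ?thesis .
qed

text \<open>Mass distribution principle: the packings force \<open>P\<close> to give balls of radius \<open>d\<close> mass
  at most \<open>K d^k\<close>. For \<open>d = 0\<close> this reads \<open>0^0 = 1\<close> when \<open>k = 0\<close>.\<close>

lemma hausdorff_pos_of_packings:
  fixes P :: "'a::{metric_space, second_countable_topology} measure"
  assumes P: "uniformly_distributed S P" and "0 < c"
    and pack: "\<And>m::nat. 0 < m \<Longrightarrow> \<exists>F. finite F \<and> F \<subseteq> S \<and> card F = m ^ k \<and>
      (\<forall>y\<in>F. \<forall>z\<in>F. y \<noteq> z \<longrightarrow> c / real m \<le> dist y z)"
  shows "0 < hausdorff k S"
proof -
  interpret prob_space P using P by (simp add: uniformly_distributed_def)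
  have sets: "sets P = sets borel" and AE: "AE x in P. x \<in> S"
    using P by (simp_all add: uniformly_distributed_def)
  \<comment> \<open>The 4 stems from the bound \<open>c / (4 * d) \<le> real m\<close> for the
    packing size chosen below.\<close>
  define K where "K = (4 / c) ^ k"
  have "0 < K" using \<open>0 < c\<close> by (simp add: K_def)
  have ball: "measure P (ball x (c / (2 * real m))) \<le> 1 / real m ^ k" if x: "x \<in> S" and m: "0 < m" for x m
  proof -
    obtain F where "finite F" "F \<subseteq> S" "card F = m ^ k"
      "\<forall>y\<in>F. \<forall>z\<in>F. y \<noteq> z \<longrightarrow> c / real m \<le> dist y z"
      using pack[OF m] by blast
    then have "measure P (ball x (c / (2 * real m))) * real (card F) \<le> 1"
      using x by (intro uniformly_distributed_ball_le[OF P]) auto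
    then show ?thesis using \<open>card F = m ^ k\<close> m by (simp add: field_simps)
  qed
  have cball: "measure P (cball x d) \<le> K * d ^ k" if "x \<in> S" "0 \<le> d" "d < c / 2" for x d
  proof -
    have sub: "measure P (cball x d) \<le> 1 / real m ^ k" if "0 < m" "d < c / (2 * real m)" for m
    proof -
      have "cball x d \<subseteq> ball x (c / (2 * real m))" using that by auto
      then have "measure P (cball x d) \<le> measure P (ball x (c / (2 * real m)))"
        by (rule finite_measure_mono) (simp add: sets)
      then show ?thesis using ball[OF \<open>x \<in> S\<close> \<open>0 < m\<close>] by linarith
    qed
    consider "k = 0" | "d = 0" "0 < k" | "0 < d" using \<open>0 \<le> d\<close> by fastforce
    then show ?thesis
    proof cases
      case 1
      then show ?thesis by (simp add: K_def)
    next
      case 2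
      \<comment> \<open>A single point lies in balls of every packing radius, so for positive
        \<open>k\<close> its mass is at most \<open>1 / m\<close> for all \<open>m\<close>.\<close>
      have "measure P (cball x d) \<le> 0 + e" if "0 < e" for e
      proof -
        obtain n where n: "1 / real (Suc n) < e" using nat_approx_posE[OF \<open>0 < e\<close>] by blast
        have "measure P (cball x d) \<le> 1 / real (Suc n) ^ k"
          using \<open>0 < c\<close> 2 by (intro sub) auto
        also have "\<dots> \<le> 1 / real (Suc n) ^ 1"
          using 2 by (intro divide_left_mono power_increasing) auto
        finally show ?thesis using n by simp
      qed
      then have "measure P (cball x d) \<le> 0" by (rule field_le_epsilon)
      then show ?thesis using 2 by (simp add: zero_power)
    next
      case 3
      \<comment> \<open>The largest integer strictly below \<open>c / (2 * d)\<close>: strictness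
        puts the closed ball inside an open ball of the packing radius. As \<open>m \<ge> 1\<close>,
        passing from \<open>m + 1\<close> back to \<open>m\<close> costs at most a factor 2.\<close>
      define m where "m = nat (\<lceil>c / (2 * d)\<rceil> - 1)"
      have gt1: "1 < c / (2 * d)" using 3 \<open>d < c / 2\<close> by (simp add: field_simps)
      then have "0 < \<lceil>c / (2 * d)\<rceil> - 1" by linarith
      then have m: "real m = of_int \<lceil>c / (2 * d)\<rceil> - 1" "0 < m" by (auto simp: m_def)
      have lt: "real m < c / (2 * d)" using m(1) by linarith
      have "c / (2 * d) \<le> real m + 1" using m(1) by linarith
      moreover have "1 \<le> real m" using m(2) by simp
      ultimately have ge: "c / (4 * d) \<le> real m" by (simp add: field_simps)
      have "measure P (cball x d) \<le> 1 / real m ^ k"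
        using lt 3 m(2) by (intro sub) (auto simp: field_simps)
      also have "\<dots> \<le> 1 / (c / (4 * d)) ^ k"
        using ge 3 \<open>0 < c\<close> by (intro divide_left_mono power_mono mult_pos_pos zero_less_power) (auto simp: m(2))
      also have "\<dots> = K * d ^ k" by (simp add: K_def power_divide power_mult_distrib)
      finally show ?thesis .
    qed
  qed
  \<comment> \<open>One scale suffices, as \<open>hausdorff\<close> is a supremum over scales;
    \<open>c / 4\<close> stays strictly below the limit \<open>c / 2\<close> of
    \<open>cball\<close>.\<close>
  have "ennreal (1 / K) \<le> hausdorff_delta k (c / 4) S"
    unfolding hausdorff_delta_def
  proof (rule INF_greatest, clarify)
    fix C :: "nat \<Rightarrow> 'a set"
    assume C: "S \<subseteq> (\<Union>i. C i)" "\<forall>i. bounded (C i) \<and> diameter (C i) \<le> c / 4"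
    \<comment> \<open>A covering set may be non-measurable and need not be a ball. The closed ball
      around one of its points in \<open>S\<close>, with its diameter as radius, contains it and has
      a controlled mass.\<close>
    define B where "B = (\<lambda>i. if C i \<inter> S = {} then {} else cball (SOME x. x \<in> C i \<inter> S) (diameter (C i)))"
    have centre: "(SOME x. x \<in> C i \<inter> S) \<in> C i \<inter> S" if "C i \<inter> S \<noteq> {}" for i
    proof -
      have "\<exists>x. x \<in> C i \<inter> S" using that by blast
      then show ?thesis by (rule someI_ex)
    qed
    have B_meas: "B i \<in> sets P" for i by (simp add: B_def sets)
    have "S \<subseteq> (\<Union>i. B i)"
    proof
      fix x assume "x \<in> S"
      then obtain i where i: "x \<in> C i" using C by blast
      then have ne: "C i \<inter> S \<noteq> {}" using \<open>x \<in> S\<close> by blast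
      have "dist (SOME x. x \<in> C i \<inter> S) x \<le> diameter (C i)"
        using centre[OF ne] i C(2) by (intro diameter_bounded_bound) auto
      then have "x \<in> B i" using ne by (simp add: B_def)
      then show "x \<in> (\<Union>i. B i)" by blast
    qed
    then have "AE x in P. x \<in> S \<longrightarrow> x \<in> (\<Union>i. B i)" by (intro AE_I2) blast
    with AE have "AE x in P. x \<in> (\<Union>i. B i)" by (rule AE_mp)
    then have "emeasure P (\<Union>i. B i) = 1"
      using B_meas by (intro emeasure_eq_1_AE) auto
    then have "1 \<le> (\<Sum>i. emeasure P (B i))"
      using emeasure_subadditive_countably[of B P] B_meas by (metis image_subsetI)
    also have "\<dots> \<le> (\<Sum>i. ennreal K * hausdorff_weight k (C i))"
    proof (intro suminf_le)
      fix i
      show "emeasure P (B i) \<le> ennreal K * hausdorff_weight k (C i)"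
      proof (cases "C i \<inter> S = {}")
        case False
        then have "C i \<noteq> {}" by auto
        have "0 \<le> diameter (C i)" using C(2) by (intro diameter_ge_0) auto
        moreover have "diameter (C i) \<le> c / 4" using C(2) by blast
        then have "diameter (C i) < c / 2" using \<open>0 < c\<close> by linarith
        ultimately have "measure P (B i) \<le> K * diameter (C i) ^ k"
          using cball centre[OF False] False by (auto simp: B_def)
        then have "emeasure P (B i) \<le> ennreal (K * diameter (C i) ^ k)"
          by (simp add: emeasure_eq_measure ennreal_leI)
        then show ?thesis
          using \<open>C i \<noteq> {}\<close> \<open>0 < K\<close> \<open>0 \<le> diameter (C i)\<close> by (simp add: ennreal_mult)
      qed (simp add: B_def)
    qed auto
    also have "\<dots> = ennreal K * (\<Sum>i. hausdorff_weight k (C i))" by simp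
    finally have "ennreal (1 / K) * 1 \<le> ennreal (1 / K) * (ennreal K * (\<Sum>i. hausdorff_weight k (C i)))"
      by (rule mult_left_mono) simp
    then show "ennreal (1 / K) \<le> (\<Sum>i. hausdorff_weight k (C i))"
      using \<open>0 < K\<close> by (simp add: mult.assoc[symmetric] ennreal_mult[symmetric])
  qed
  then have "ennreal (1 / K) \<le> hausdorff k S"
    using hausdorff_delta_le_hausdorff[of "c / 4" k S] \<open>0 < c\<close> by (auto intro: order_trans)
  then show ?thesis using \<open>0 < K\<close> by (auto intro: less_le_trans[rotated])
qed

section \<open>Packings and coverings of a sphere in a coordinate hyperplane\<close>

lemma sum_three_coordinates:
  fixes h :: "'n::finite \<Rightarrow> 'a::comm_monoid_add"
  assumes "i \<noteq> j"
  shows "(\<Sum>k\<in>UNIV. h k) = h i + h j + (\<Sum>k\<in>UNIV - {i, j}. h k)"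
proof -
  have "(\<Sum>k\<in>UNIV. h k) = (\<Sum>k\<in>UNIV - {i, j}. h k) + (\<Sum>k\<in>{i, j}. h k)"
    by (intro sum.subset_diff) auto
  then show ?thesis using assms by (simp add: ac_simps)
qed

lemma norm_squared_vec: "(norm (z :: real ^ 'n))\<^sup>2 = (\<Sum>k\<in>UNIV. (z $ k)\<^sup>2)"
  by (simp add: norm_vec_def L2_set_def sum_nonneg)

text \<open>A rotated copy of the shell, aligned with the axes so that grids in the coordinates can
  be used.\<close>

definition coordinate_sphere :: "'n \<Rightarrow> real \<Rightarrow> (real ^ 'n) set" where
  "coordinate_sphere i a = {z. z $ i = 0 \<and> norm z = a}"

text \<open>Part of the sphere is a graph over the coordinates other than \<open>i\<close> and
  \<open>j\<close>. A grid with \<open>m\<close> values in each of them is lifted to it; lifting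
  cannot decrease distances.\<close>

lemma coordinate_sphere_packing:
  fixes i :: "'n::finite"
  assumes "0 < a" and N: "CARD('n) \<ge> 2" and "0 < (m::nat)"
  shows "\<exists>F. finite F \<and> F \<subseteq> coordinate_sphere i a \<and> card F = m ^ (CARD('n) - 2) \<and>
    (\<forall>y\<in>F. \<forall>z\<in>F. y \<noteq> z \<longrightarrow> a / real CARD('n) / real m \<le> dist y (z :: real ^ 'n))"
proof -
  have "\<exists>j. i \<noteq> j"
  proof (rule ccontr)
    assume "\<not> ?thesis"
    then have "UNIV = {i}" by auto
    then have "CARD('n) = card {i}" by simp
    then show False using N by simp
  qed
  then obtain j where j: "i \<noteq> j" ..
  \<comment> \<open>Grid values stay below \<open>a / N\<close>, so their squares sum to at most
    \<open>a\<^sup>2\<close> and coordinate \<open>j\<close> can be solved for by a square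
    root.\<close>
  define c where "c = a / real CARD('n)"
  have "0 < c" using \<open>0 < a\<close> by (simp add: c_def)
  define K where "K = UNIV - {i, j}"
  have card_K: "card K = CARD('n) - 2" using j by (simp add: K_def card_Diff_subset)
  define G where "G = K \<rightarrow>\<^sub>E {..<m}"
  define w where "w = (\<lambda>(g :: 'n \<Rightarrow> nat) k. c * real (g k) / real m)"
  define z :: "('n \<Rightarrow> nat) \<Rightarrow> real ^ 'n" where
    "z g = (\<chi> k. if k = i then 0 else if k = j then sqrt (a\<^sup>2 - (\<Sum>l\<in>K. (w g l)\<^sup>2)) else w g k)" for g
  have z_K: "z g $ k = w g k" if "k \<in> K" for g k using that by (auto simp: z_def K_def)
  have in_sphere: "z g \<in> coordinate_sphere i a" if "g \<in> G" for g
  proof -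
    have "(w g l)\<^sup>2 \<le> c\<^sup>2" if "l \<in> K" for l
    proof -
      have "g l < m" using \<open>g \<in> G\<close> that by (auto simp: G_def)
      then have "w g l \<le> c" using \<open>0 < c\<close> by (simp add: w_def field_simps)
      moreover have "0 \<le> w g l" using \<open>0 < c\<close> by (simp add: w_def)
      ultimately show ?thesis by (intro power_mono)
    qed
    then have "(\<Sum>l\<in>K. (w g l)\<^sup>2) \<le> real (card K) * c\<^sup>2" by (rule sum_bounded_above)
    also have "\<dots> \<le> real CARD('n) * real CARD('n) * c\<^sup>2"
    proof (intro mult_right_mono)
      have "real (card K) \<le> real CARD('n) * 1" by (simp add: card_K)
      also have "\<dots> \<le> real CARD('n) * real CARD('n)" using N by (intro mult_left_mono) auto
      finally show "real (card K) \<le> real CARD('n) * real CARD('n)" .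
    qed simp
    also have "\<dots> = a\<^sup>2" by (simp add: c_def power2_eq_square)
    finally have "(\<Sum>l\<in>K. (w g l)\<^sup>2) \<le> a\<^sup>2" .
    then have "(norm (z g))\<^sup>2 = a\<^sup>2"
      using j by (simp add: norm_squared_vec sum_three_coordinates[OF j] K_def[symmetric] z_K)
        (simp add: z_def)
    then have "norm (z g) = a" using \<open>0 < a\<close> by (simp add: power2_eq_iff_nonneg)
    then show ?thesis by (simp add: coordinate_sphere_def z_def)
  qed
  have sep: "c / real m \<le> dist (z g) (z h)" if g: "g \<in> G" "h \<in> G" "g \<noteq> h" for g h
  proof -
    obtain k where k: "k \<in> K" "g k \<noteq> h k" using g unfolding G_def by (metis PiE_ext)
    have "1 \<le> \<bar>real (g k) - real (h k)\<bar>" using k by linarith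
    then have "c / real m * 1 \<le> c / real m * \<bar>real (g k) - real (h k)\<bar>"
      using \<open>0 < c\<close> by (intro mult_left_mono) auto
    also have "\<dots> = \<bar>w g k - w h k\<bar>"
      using \<open>0 < c\<close> by (simp add: w_def abs_mult abs_divide flip: right_diff_distrib diff_divide_distrib)
    also have "\<dots> = dist (z g $ k) (z h $ k)" using k by (simp add: z_K dist_real_def)
    also have "\<dots> \<le> dist (z g) (z h)" by (rule dist_vec_nth_le)
    finally show ?thesis by simp
  qed
  have "inj_on z G"
  proof (rule inj_onI, rule ccontr)
    fix g h assume "g \<in> G" "h \<in> G" "z g = z h" "g \<noteq> h"
    then have "c / real m \<le> 0" using sep[of g h] by simp
    then show False using \<open>0 < c\<close> \<open>0 < m\<close> by (simp add: field_simps)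
  qed
  then have "card (z ` G) = m ^ (CARD('n) - 2)"
    by (simp add: card_image G_def card_PiE K_def[symmetric] card_K)
  moreover have "finite G" by (simp add: G_def finite_PiE)
  ultimately show ?thesis
    using in_sphere sep by (intro exI[of _ "z ` G"]) (auto simp: c_def)
qed

text \<open>Where the coordinate \<open>j\<close> is bounded away from \<open>0\<close>, it is a Lipschitz function of the
  remaining ones.\<close>

lemma coordinate_sphere_dist_le:
  fixes y z :: "real ^ 'n"
  assumes "0 < a" "i \<noteq> j" and yz: "y \<in> coordinate_sphere i a" "z \<in> coordinate_sphere i a"
    and s: "s = 1 \<or> s = -1" "a / real CARD('n) \<le> s * y $ j" "a / real CARD('n) \<le> s * z $ j"
    and \<epsilon>: "\<And>k. k \<in> UNIV - {i, j} \<Longrightarrow> \<bar>y $ k - z $ k\<bar> \<le> \<epsilon>" and "0 \<le> \<epsilon>"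
  shows "dist y z \<le> real CARD('n) ^ 3 * \<epsilon>"
proof -
  let ?N = "real CARD('n)"
  have N: "1 \<le> ?N" using one_le_card_finite[where 'a='n] by linarith
  have i0: "y $ i = 0" "z $ i = 0" and norms: "norm y = a" "norm z = a"
    using yz by (auto simp: coordinate_sphere_def)
  have le_a: "\<bar>y $ k\<bar> \<le> a" "\<bar>z $ k\<bar> \<le> a" for k
    using component_le_norm_cart[of y k] component_le_norm_cart[of z k] norms by auto
  have "(\<Sum>k\<in>UNIV. (y $ k)\<^sup>2) = (\<Sum>k\<in>UNIV. (z $ k)\<^sup>2)"
    using norms by (simp flip: norm_squared_vec)
  then have "(y $ j)\<^sup>2 - (z $ j)\<^sup>2 = (\<Sum>k\<in>UNIV - {i, j}. (z $ k)\<^sup>2 - (y $ k)\<^sup>2)"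
    using i0 by (simp add: sum_three_coordinates[OF \<open>i \<noteq> j\<close>] sum_subtractf)
  then have "\<bar>y $ j - z $ j\<bar> * \<bar>y $ j + z $ j\<bar> = \<bar>\<Sum>k\<in>UNIV - {i, j}. (z $ k)\<^sup>2 - (y $ k)\<^sup>2\<bar>"
    by (simp add: power2_eq_square square_diff_square_factored flip: abs_mult) (simp add: mult.commute)
  also have "\<dots> \<le> (\<Sum>k\<in>UNIV - {i, j}. \<bar>(z $ k)\<^sup>2 - (y $ k)\<^sup>2\<bar>)" by (rule sum_abs)
  also have "\<dots> \<le> (\<Sum>k\<in>UNIV - {i, j}. \<epsilon> * (2 * a))"
  proof (rule sum_mono)
    fix k assume k: "k \<in> UNIV - {i, j}"
    have "\<bar>(z $ k)\<^sup>2 - (y $ k)\<^sup>2\<bar> = \<bar>y $ k - z $ k\<bar> * \<bar>y $ k + z $ k\<bar>"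
      by (simp add: power2_eq_square abs_minus_commute square_diff_square_factored abs_mult) (simp add: mult.commute abs_minus_commute add.commute)
    also have "\<dots> \<le> \<epsilon> * (2 * a)"
      using \<epsilon>[OF k] le_a[of k] \<open>0 \<le> \<epsilon>\<close> by (intro mult_mono) auto
    finally show "\<bar>(z $ k)\<^sup>2 - (y $ k)\<^sup>2\<bar> \<le> \<epsilon> * (2 * a)" .
  qed
  also have "\<dots> \<le> ?N * (\<epsilon> * (2 * a))"
    using \<open>0 \<le> \<epsilon>\<close> \<open>0 < a\<close> by (simp add: mult_right_mono card_mono)
  finally have "\<bar>y $ j - z $ j\<bar> * \<bar>y $ j + z $ j\<bar> \<le> ?N * (\<epsilon> * (2 * a))" .
  \<comment> \<open>Both \<open>j\<close> coordinates have the sign \<open>s\<close> and modulus at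
    least \<open>a / N\<close>, so nothing cancels in their sum. Dividing by it bounds their
    difference.\<close>
  moreover have "2 * a / ?N \<le> \<bar>y $ j + z $ j\<bar>" using s by auto
  then have "\<bar>y $ j - z $ j\<bar> * (2 * a / ?N) \<le> \<bar>y $ j - z $ j\<bar> * \<bar>y $ j + z $ j\<bar>"
    by (intro mult_left_mono) auto
  ultimately have "\<bar>y $ j - z $ j\<bar> * (2 * a / ?N) \<le> ?N * (\<epsilon> * (2 * a))" by linarith
  then have j_le: "\<bar>y $ j - z $ j\<bar> \<le> ?N ^ 2 * \<epsilon>"
    using \<open>0 < a\<close> N by (simp add: field_simps power2_eq_square)
  have "1 * \<epsilon> \<le> ?N ^ 2 * \<epsilon>" using N \<open>0 \<le> \<epsilon>\<close> by (intro mult_right_mono one_le_power)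
  then have "\<bar>y $ k - z $ k\<bar> \<le> ?N ^ 2 * \<epsilon>" for k
    using \<epsilon>[of k] j_le i0 \<open>0 \<le> \<epsilon>\<close> by (cases "k = i"; cases "k = j") auto
  \<comment> \<open>The third factor \<open>N\<close> comes from summing all coordinates in the l1
    norm, which dominates the Euclidean one.\<close>
  then have "(\<Sum>k\<in>UNIV. \<bar>(y - z) $ k\<bar>) \<le> (\<Sum>k\<in>(UNIV :: 'n set). ?N ^ 2 * \<epsilon>)"
    by (intro sum_mono) simp
  also have "\<dots> = ?N ^ 3 * \<epsilon>" by (simp add: eval_nat_numeral)
  finally show ?thesis using norm_le_l1_cart[of "y - z"] by (simp add: dist_norm)
qed

text \<open>Only the \<open>N - 2\<close> coordinates other than \<open>i\<close> and
  \<open>j\<close> are put on a grid of mesh \<open>1 / m\<close>. The norm then confines coordinate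
  \<open>j\<close>, provided it is large and of known sign; this yields the power
  \<open>N - 2\<close> of \<open>m\<close>. The factor \<open>2 * N\<close> counts the choices of
  sign and of \<open>j\<close>.\<close>

lemma coordinate_sphere_covering:
  fixes i :: "'n::finite"
  assumes "0 < a" and N: "CARD('n) \<ge> 2" and "0 < (m::nat)"
  shows "\<exists>\<C>. finite \<C> \<and> coordinate_sphere i a \<subseteq> \<Union>\<C> \<and>
    real (card \<C>) \<le> 2 * real CARD('n) * (2 * of_int \<lceil>a\<rceil> + 1) ^ (CARD('n) - 2) * real m ^ (CARD('n) - 2) \<and>
    (\<forall>X\<in>\<C>. bounded X \<and> diameter (X :: (real ^ 'n) set) \<le> real CARD('n) ^ 3 / real m)"
proof -
  define A where "A = \<lceil>a\<rceil>"
  have A: "0 < A" "a \<le> of_int A" using \<open>0 < a\<close> by (auto simp: A_def)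
  define R where "R = {- A * int m .. A * int m}"
  \<comment> \<open>\<open>j\<close> is a coordinate of modulus at least \<open>a / N\<close>,
    \<open>s\<close> its sign, and \<open>g\<close> the grid position of the remaining
    coordinates.\<close>
  define cell where "cell = (\<lambda>(j, s, g). {z \<in> coordinate_sphere i a. a / real CARD('n) \<le> s * z $ j \<and>
     (\<forall>k\<in>UNIV - {i, j}. \<lfloor>real m * z $ k\<rfloor> = g k)})"
  define keys where "keys = (SIGMA j:UNIV - {i}. {1, - 1 :: real} \<times> ((UNIV - {i, j}) \<rightarrow>\<^sub>E R))"
  have fin: "finite keys" unfolding keys_def R_def by (intro finite_SigmaI finite_cartesian_product finite_PiE) auto
  have "card keys = (\<Sum>j\<in>UNIV - {i}. card ({1, - 1 :: real} \<times> ((UNIV - {i, j}) \<rightarrow>\<^sub>E R)))"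
    unfolding keys_def R_def by (intro card_SigmaI ballI finite_cartesian_product finite_PiE) auto
  also have "\<dots> = (\<Sum>j\<in>UNIV - {i}. 2 * card R ^ (CARD('n) - 2))"
  proof (rule sum.cong[OF refl])
    fix j assume "j \<in> UNIV - {i}"
    then have "card (UNIV - {i, j}) = CARD('n) - 2" by (simp add: card_Diff_subset)
    then show "card ({1, - 1 :: real} \<times> ((UNIV - {i, j}) \<rightarrow>\<^sub>E R)) = 2 * card R ^ (CARD('n) - 2)"
      by (simp add: card_cartesian_product card_PiE)
  qed
  also have "\<dots> = (CARD('n) - 1) * (2 * card R ^ (CARD('n) - 2))" by (simp add: card_Diff_subset)
  finally have card_keys: "real (card keys) \<le> 2 * real CARD('n) * real (card R) ^ (CARD('n) - 2)"
    by (simp add: mult_right_mono)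
  have "real (card R) = 2 * of_int A * real m + 1" using A by (simp add: R_def)
  also have "\<dots> \<le> (2 * of_int A + 1) * real m" using \<open>0 < m\<close> by (simp add: algebra_simps)
  finally have card_R: "real (card R) \<le> (2 * of_int A + 1) * real m" .
  have "real (card (cell ` keys)) \<le> real (card keys)" using card_image_le[OF fin] by simp
  also have "\<dots> \<le> 2 * real CARD('n) * ((2 * of_int A + 1) * real m) ^ (CARD('n) - 2)"
    using card_R by (intro order_trans[OF card_keys] mult_left_mono power_mono) auto
  finally have card: "real (card (cell ` keys)) \<le>
      2 * real CARD('n) * (2 * of_int A + 1) ^ (CARD('n) - 2) * real m ^ (CARD('n) - 2)"
    by (simp add: power_mult_distrib mult.assoc)
  have cover: "coordinate_sphere i a \<subseteq> \<Union>(cell ` keys)"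
  proof
    fix z :: "real ^ 'n" assume z: "z \<in> coordinate_sphere i a"
    then have z0: "z $ i = 0" "norm z = a" by (auto simp: coordinate_sphere_def)
    \<comment> \<open>Otherwise the l1 norm of \<open>z\<close> would be below \<open>a\<close>,
      although it dominates the Euclidean norm.\<close>
    have "\<exists>j. a / real CARD('n) \<le> \<bar>z $ j\<bar>"
    proof (rule ccontr)
      assume "\<not> ?thesis"
      then have "\<bar>z $ j\<bar> < a / real CARD('n)" for j by (simp add: not_le)
      then have "(\<Sum>j\<in>UNIV. \<bar>z $ j\<bar>) < (\<Sum>j\<in>(UNIV :: 'n set). a / real CARD('n))"
        by (intro sum_strict_mono) auto
      then show False using norm_le_l1_cart[of z] z0 by simp
    qed
    then obtain j where j: "a / real CARD('n) \<le> \<bar>z $ j\<bar>" ..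
    moreover have "0 < a / real CARD('n)" using \<open>0 < a\<close> by simp
    ultimately have "j \<noteq> i" using z0 by auto
    define s :: real where "s = (if z $ j \<ge> 0 then 1 else -1)"
    define g where "g = restrict (\<lambda>k. \<lfloor>real m * z $ k\<rfloor>) (UNIV - {i, j})"
    have "\<lfloor>real m * z $ k\<rfloor> \<in> R" for k
    proof -
      have "\<bar>z $ k\<bar> \<le> of_int A" using component_le_norm_cart[of z k] z0 A by simp
      then have "\<bar>real m * z $ k\<bar> \<le> real m * of_int A" by (simp add: abs_mult mult_left_mono)
      then have "- (of_int (A * int m)) \<le> real m * z $ k" "real m * z $ k \<le> of_int (A * int m)"
        by (auto simp: mult.commute)
      then show ?thesis unfolding R_def by (simp add: le_floor_iff floor_le_iff)
    qed
    then have "(j, s, g) \<in> keys" using \<open>j \<noteq> i\<close> by (auto simp: keys_def s_def g_def)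
    moreover have "z \<in> cell (j, s, g)" using z j by (auto simp: cell_def s_def g_def)
    ultimately show "z \<in> \<Union>(cell ` keys)" by blast
  qed
  have small: "bounded X \<and> diameter X \<le> real CARD('n) ^ 3 / real m" if X_in: "X \<in> cell ` keys" for X
  proof
    obtain j s g where X: "X = cell (j, s, g)" "(j, s, g) \<in> keys" using X_in by auto
    show "bounded X"
      unfolding bounded_iff X(1) by (intro exI[of _ a]) (auto simp: cell_def coordinate_sphere_def)
    show "diameter X \<le> real CARD('n) ^ 3 / real m"
    proof (rule diameter_le)
      fix y z assume yz: "y \<in> X" "z \<in> X"
      have "\<bar>y $ k - z $ k\<bar> \<le> 1 / real m" if "k \<in> UNIV - {i, j}" for k
      proof -
        have "\<lfloor>real m * y $ k\<rfloor> = \<lfloor>real m * z $ k\<rfloor>" using yz that by (auto simp: X cell_def)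
        then have "\<bar>real m * y $ k - real m * z $ k\<bar> \<le> 1" by linarith
        moreover have "\<bar>real m * y $ k - real m * z $ k\<bar> = real m * \<bar>y $ k - z $ k\<bar>"
          by (simp add: abs_mult flip: right_diff_distrib)
        ultimately show ?thesis using \<open>0 < m\<close> by (simp add: pos_le_divide_eq mult.commute)
      qed
      then have "dist y z \<le> real CARD('n) ^ 3 * (1 / real m)"
        using yz X \<open>0 < a\<close>
        by (intro coordinate_sphere_dist_le[of a i j y z s]) (auto simp: cell_def keys_def)
      then show "norm (y - z) \<le> real CARD('n) ^ 3 / real m" by (simp add: dist_norm)
    qed simp
  qed
  show ?thesis
    using fin cover card small by (intro exI[of _ "cell ` keys"]) (auto simp: A_def)
qed

section \<open>Spheres in a hyperplane\<close>

lemma dist_orthogonal_transformation: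
  assumes "orthogonal_transformation f" shows "dist (f x) (f y) = dist x y"
proof -
  have "f (x - y) = f x - f y" using assms by (simp add: linear_diff orthogonal_transformation_def)
  then have "norm (f x - f y) = norm (f (x - y))" by simp
  also have "\<dots> = norm (x - y)" using assms by (rule orthogonal_transformation_norm)
  finally show ?thesis by (simp add: dist_norm)
qed

text \<open>The Householder reflection along \<open>x - y\<close>. It fixes everything orthogonal to
  \<open>x - y\<close>, in particular the normal \<open>u\<close> when \<open>x\<close> and
  \<open>y\<close> lie on the same sphere in its hyperplane.\<close>

lemma orthogonal_transformation_swap:
  fixes x y :: "'a::euclidean_space"
  assumes "norm x = norm y"
  obtains f where "orthogonal_transformation f" "f x = y"
    "\<And>u. u \<bullet> x = u \<bullet> y \<Longrightarrow> f u = u"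
proof (cases "x = y")
  case True
  then show ?thesis using that[of "\<lambda>v. v"] by simp
next
  case False
  define d where "d = x - y"
  define f where "f = (\<lambda>v. v - (2 * (v \<bullet> d) / (d \<bullet> d)) *\<^sub>R d)"
  have d: "d \<bullet> d \<noteq> 0" using False by (simp add: d_def)
  have xy: "x \<bullet> x = y \<bullet> y" using assms by (simp add: norm_eq)
  show ?thesis
  proof (rule that)
    have "f v \<bullet> f w = v \<bullet> w" for v w
    proof -
      define p q where "p = 2 * (v \<bullet> d) / (d \<bullet> d)" and "q = 2 * (w \<bullet> d) / (d \<bullet> d)"
      have "f v \<bullet> f w = v \<bullet> w - q * (v \<bullet> d) - p * (w \<bullet> d) + p * (q * (d \<bullet> d))"
        unfolding f_def p_def[symmetric] q_def[symmetric]
        by (simp add: inner_diff_left inner_diff_right inner_commute[of d w] right_diff_distrib)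
      also have "q * (d \<bullet> d) = 2 * (w \<bullet> d)" using d by (simp add: q_def)
      also have "q * (v \<bullet> d) = p * (w \<bullet> d)" by (simp add: p_def q_def)
      finally show ?thesis by simp
    qed
    moreover have "linear f"
    proof (rule linearI)
      show "f (v + w) = f v + f w" for v w
        by (simp add: f_def inner_add_left distrib_left add_divide_distrib scaleR_add_left)
      show "f (r *\<^sub>R v) = r *\<^sub>R f v" for r v
        by (simp add: f_def scaleR_diff_right mult.left_commute)
    qed
    ultimately show "orthogonal_transformation f" by (simp add: orthogonal_transformation_def)
    \<comment> \<open>Equality of the norms enters here: it makes the coefficient of
      \<open>d\<close> in \<open>f x\<close> equal to 1.\<close>
    have "2 * (x \<bullet> d) = d \<bullet> d"
      using xy by (simp add: d_def inner_diff_left inner_diff_right inner_commute[of y x])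
    then show "f x = y" using d by (simp add: f_def) (simp add: d_def)
    show "f u = u" if "u \<bullet> x = u \<bullet> y" for u
      using that by (simp add: f_def d_def inner_diff_right)
  qed
qed

section \<open>Radial projection onto a sphere in a hyperplane\<close>

definition perp :: "'a::euclidean_space \<Rightarrow> 'a \<Rightarrow> 'a" where
  "perp u x = x - (x \<bullet> u) *\<^sub>R u"

definition perp_sphere :: "'a::euclidean_space \<Rightarrow> real \<Rightarrow> 'a set" where
  "perp_sphere u a = {x. x \<bullet> u = 0 \<and> norm x = a}"

text \<open>Where \<open>perp u x = 0\<close> the value is 0 by division by zero, hence off the
  sphere for positive \<open>a\<close>. In dimension at least 2 this happens only on a null
  set.\<close>

definition sphere_projection :: "'a::euclidean_space \<Rightarrow> real \<Rightarrow> 'a \<Rightarrow> 'a" where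
  "sphere_projection u a x = (a / norm (perp u x)) *\<^sub>R perp u x"

lemma perp_inner:
  assumes "norm u = 1" shows "perp u x \<bullet> u = 0"
proof -
  have "u \<bullet> u = 1" using assms by (simp only: norm_eq_1)
  then show ?thesis unfolding perp_def inner_diff_left inner_scaleR_left by simp
qed

lemma norm_perp:
  assumes "norm u = 1" shows "(norm (perp u x))\<^sup>2 = (norm x)\<^sup>2 - (x \<bullet> u)\<^sup>2"
proof -
  have "u \<bullet> u = 1" using assms by (simp only: norm_eq_1)
  then show ?thesis
    unfolding power2_norm_eq_inner perp_def inner_diff_left inner_diff_right inner_scaleR_left
      inner_scaleR_right inner_commute[of u x]
    by (simp add: power2_eq_square)
qed

lemma borel_measurable_sphere_projection [measurable]: "sphere_projection u a \<in> borel_measurable borel"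
  unfolding sphere_projection_def perp_def by measurable

lemma sphere_projection_in_perp_sphere:
  "norm u = 1 \<Longrightarrow> 0 \<le> a \<Longrightarrow> perp u x \<noteq> 0 \<Longrightarrow> sphere_projection u a x \<in> perp_sphere u a"
  by (simp add: sphere_projection_def perp_sphere_def perp_inner)

text \<open>\<open>f\<close> preserves norms and the component along its fixed vector
  \<open>u\<close>, so it commutes with \<open>perp u\<close>. This equivariance is what transfers
  symmetry from a measure to its projection.\<close>

lemma sphere_projection_orthogonal:
  assumes "orthogonal_transformation f" "f u = u"
  shows "sphere_projection u a (f x) = f (sphere_projection u a x)"
proof -
  have "linear f" and inner: "\<And>v w. f v \<bullet> f w = v \<bullet> w"
    using assms by (auto simp: orthogonal_transformation_def)
  have "f x \<bullet> u = x \<bullet> u" using inner[of x u] assms(2) by simp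
  then have perp: "perp u (f x) = f (perp u x)"
    using assms(2) by (simp add: perp_def linear_diff[OF \<open>linear f\<close>] linear_cmul[OF \<open>linear f\<close>])
  show ?thesis
    unfolding sphere_projection_def perp orthogonal_transformation_norm[OF assms(1)]
    by (simp add: linear_cmul[OF \<open>linear f\<close>])
qed

text \<open>Pythagoras, then multiplication of \<open>(r - a)\<^sup>2\<close> by
  \<open>(r + a)\<^sup>2 / a\<^sup>2\<close>, which is at least 1. For \<open>r = 0\<close> the
  conventions of division make the radial term vanish.\<close>

lemma dist_sphere_projection_le:
  assumes "norm u = 1" "0 < a"
  shows "(norm (x - sphere_projection u a x))\<^sup>2 \<le> (x \<bullet> u)\<^sup>2 + ((norm (perp u x))\<^sup>2 - a\<^sup>2)\<^sup>2 / a\<^sup>2"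
proof -
  define r where "r = norm (perp u x)"
  have uu: "u \<bullet> u = 1" using assms(1) by (simp only: norm_eq_1)
  have pu: "perp u x \<bullet> u = 0" "u \<bullet> perp u x = 0"
    using perp_inner[OF assms(1)] by (simp_all add: inner_commute)
  have eq: "x - sphere_projection u a x = (x \<bullet> u) *\<^sub>R u + (1 - a / r) *\<^sub>R perp u x"
    unfolding sphere_projection_def r_def by (simp add: perp_def algebra_simps)
  have "(norm (x - sphere_projection u a x))\<^sup>2 = (x \<bullet> u)\<^sup>2 + (1 - a / r)\<^sup>2 * r\<^sup>2"
    unfolding eq r_def power2_norm_eq_inner
    by (simp add: inner_add_left inner_add_right uu pu) (simp add: power2_eq_square)
  also have "(1 - a / r)\<^sup>2 * r\<^sup>2 \<le> (r\<^sup>2 - a\<^sup>2)\<^sup>2 / a\<^sup>2"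
  proof (cases "r = 0")
    case False
    then have "0 < r" by (simp add: r_def)
    have "(1 - a / r)\<^sup>2 * r\<^sup>2 = (r - a)\<^sup>2"
      using \<open>0 < r\<close> by (simp add: power_mult_distrib[symmetric] left_diff_distrib)
    also have "\<dots> = (r - a)\<^sup>2 * a\<^sup>2 / a\<^sup>2" using assms by simp
    also have "\<dots> \<le> (r - a)\<^sup>2 * (r + a)\<^sup>2 / a\<^sup>2"
      using assms \<open>0 < r\<close> by (intro divide_right_mono mult_left_mono power_mono) auto
    also have "(r - a)\<^sup>2 * (r + a)\<^sup>2 = (r\<^sup>2 - a\<^sup>2)\<^sup>2"
      by (simp add: power_mult_distrib[symmetric] power2_eq_square algebra_simps)
    finally show ?thesis .
  qed simp
  finally show ?thesis by (simp add: r_def)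
qed

lemma AE_lborel_perp_nonzero:
  fixes u :: "'a::euclidean_space"
  assumes "DIM('a) \<ge> 2"
  shows "AE x in lborel. perp u x \<noteq> 0"
proof -
  have "dim (span {u}) \<le> card {u}" unfolding dim_span by (rule dim_le_card') simp
  then have "negligible (span {u})" using assms by (intro negligible_lowdim) auto
  then have "AE x in lebesgue. x \<notin> span {u}"
    by (intro AE_not_in) (simp add: negligible_iff_null_sets)
  then have "AE x in lborel. x \<notin> span {u}" by (simp add: AE_completion_iff)
  then show ?thesis
  proof eventually_elim
    case (elim x)
    show ?case
    proof
      assume "perp u x = 0"
      then have "x = (x \<bullet> u) *\<^sub>R u" by (simp add: perp_def)
      then have "x \<in> span {u}" by (metis span_base span_scale singletonI)
      then show False using elim by simp
    qed
  qed
qed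

text \<open>The reflection exchanging two centres fixes \<open>u\<close>, preserves \<open>P\<close>
  and commutes with the projection, so it matches the preimages of the two balls.\<close>

lemma uniformly_distributed_sphere_projection:
  fixes u :: "'a::euclidean_space"
  assumes "prob_space P" "sets P = sets borel" and u: "norm u = 1" and "0 \<le> a"
    and AE: "AE x in P. perp u x \<noteq> 0"
    and invariant: "\<And>f. orthogonal_transformation f \<Longrightarrow> f u = u \<Longrightarrow> distr P borel f = P"
  shows "uniformly_distributed (perp_sphere u a) (distr P borel (sphere_projection u a))"
proof -
  interpret prob_space P by fact
  note [measurable_cong] = \<open>sets P = sets borel\<close>
  have space: "space P = UNIV" using assms(2) by (auto dest: sets_eq_imp_space_eq)
  let ?\<nu> = "distr P borel (sphere_projection u a)"
  have S_meas [measurable]: "perp_sphere u a \<in> sets borel"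
    unfolding perp_sphere_def by measurable
  have "prob_space ?\<nu>" by (rule prob_space_distr) measurable
  moreover have "AE x in P. sphere_projection u a x \<in> perp_sphere u a"
    using AE by eventually_elim (rule sphere_projection_in_perp_sphere[OF u \<open>0 \<le> a\<close>])
  then have "AE x in ?\<nu>. x \<in> perp_sphere u a" by (subst AE_distr_iff) auto
  moreover have "emeasure ?\<nu> (ball x r) = emeasure ?\<nu> (ball y r)"
    if "x \<in> perp_sphere u a" "y \<in> perp_sphere u a" for x y r
  proof -
    have "norm x = norm y" "u \<bullet> x = u \<bullet> y" using that by (auto simp: perp_sphere_def inner_commute)
    then obtain f where f: "orthogonal_transformation f" "f x = y" "f u = u"
      using orthogonal_transformation_swap by metis
    note [measurable] = borel_measurable_orthogonal_transformation[OF f(1)]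
    have "dist (f v) (f w) = dist v w" for v w
      using f(1) by (rule dist_orthogonal_transformation)
    then have mem: "f v \<in> ball y r \<longleftrightarrow> v \<in> ball x r" for v
      unfolding f(2)[symmetric] by simp
    have V: "sphere_projection u a -` ball y r \<in> sets borel"
      using measurable_sets[of "sphere_projection u a" borel borel "ball y r"] by simp
    have "emeasure ?\<nu> (ball y r) = emeasure P (sphere_projection u a -` ball y r)"
      by (simp add: emeasure_distr space)
    also have "\<dots> = emeasure (distr P borel f) (sphere_projection u a -` ball y r)"
      using invariant[OF f(1,3)] by simp
    also have "\<dots> = emeasure P (f -` (sphere_projection u a -` ball y r))"
      using V by (simp add: emeasure_distr space)
    also have "f -` (sphere_projection u a -` ball y r) = sphere_projection u a -` ball x r"
      using mem by (auto simp: sphere_projection_orthogonal[OF f(1,3)])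
    also have "emeasure P \<dots> = emeasure ?\<nu> (ball x r)" by (simp add: emeasure_distr space)
    finally show ?thesis by simp
  qed
  moreover have "sets ?\<nu> = sets borel" by simp
  ultimately show ?thesis unfolding uniformly_distributed_def by blast
qed

text \<open>The same reflections are isometries of the sphere, so its intersections with balls of
  equal radius centred on it are congruent. The two bounds make the normalised measure a
  probability.\<close>

lemma uniformly_distributed_hausdorff:
  fixes u :: "'a::euclidean_space"
  assumes "0 < hausdorff k (perp_sphere u a)" "hausdorff k (perp_sphere u a) < top"
  shows "uniformly_distributed (perp_sphere u a) (uniform_measure (hausdorff_measure k) (perp_sphere u a))"
proof -
  let ?S = "perp_sphere u a" and ?U = "uniform_measure (hausdorff_measure k) (perp_sphere u a)"
  have S_meas [measurable]: "?S \<in> sets borel"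
    unfolding perp_sphere_def by measurable
  have prob_U: "prob_space ?U"
    using assms by (intro prob_space_uniform_measure) (auto simp: emeasure_hausdorff_measure less_top)
  have AE_U: "AE x in ?U. x \<in> ?S" by (rule AE_uniform_measureI) auto
  have le: "hausdorff k (?S \<inter> ball y r) \<le> hausdorff k (?S \<inter> ball x r)"
    if "x \<in> ?S" "y \<in> ?S" for x y r
  proof -
    have "norm x = norm y" "u \<bullet> x = u \<bullet> y" using that by (auto simp: perp_sphere_def inner_commute)
    then obtain f where f: "orthogonal_transformation f" "f x = y" "f u = u"
      using orthogonal_transformation_swap by metis
    have iso: "dist (f v) (f w) = dist v w" for v w
      using f(1) by (rule dist_orthogonal_transformation)
    have "?S \<inter> ball y r \<subseteq> f ` (?S \<inter> ball x r)"
    proof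
      fix z assume z: "z \<in> ?S \<inter> ball y r"
      obtain w where w: "z = f w" using orthogonal_transformation_surj[OF f(1)] by (metis surjD)
      have "w \<bullet> u = z \<bullet> u" "norm w = norm z"
        using f w by (metis orthogonal_transformation_def, metis orthogonal_transformation)
      moreover have "dist x w = dist y z" using iso[of x w] f w by simp
      ultimately show "z \<in> f ` (?S \<inter> ball x r)"
        using z w by (auto simp: perp_sphere_def)
    qed
    then show ?thesis using hausdorff_isometric_image_le[OF iso] hausdorff_mono by (metis order_trans)
  qed
  have eq: "hausdorff k (?S \<inter> ball x r) = hausdorff k (?S \<inter> ball y r)"
    if "x \<in> ?S" "y \<in> ?S" for x y r
    using le that by (intro antisym) auto
  have ball_U: "emeasure ?U (ball x r) = emeasure ?U (ball y r)" if "x \<in> ?S" "y \<in> ?S" for x y r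
    using eq[OF that, of r] by (simp add: emeasure_hausdorff_measure)
  have "sets ?U = sets borel" by simp
  then show ?thesis unfolding uniformly_distributed_def using prob_U AE_U ball_U by blast
qed

section \<open>Rotation of the coordinate estimates to an arbitrary normal vector\<close>

lemma perp_sphere_eq_image:
  fixes f :: "real ^ 'n \<Rightarrow> real ^ 'n"
  assumes f: "orthogonal_transformation f" "f (axis i 1) = u"
  shows "perp_sphere u a = f ` coordinate_sphere i a"
proof -
  have *: "f z \<bullet> u = z $ i" "norm (f z) = norm z" for z
    using f by (metis orthogonal_transformation_def cart_eq_inner_axis) (metis f(1) orthogonal_transformation)
  show ?thesis
  proof safe
    fix x assume x: "x \<in> perp_sphere u a"
    obtain z where "x = f z" using orthogonal_transformation_surj[OF f(1)] by (metis surjD)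
    then show "x \<in> f ` coordinate_sphere i a" using x * by (auto simp: perp_sphere_def coordinate_sphere_def)
  qed (use * in \<open>auto simp: perp_sphere_def coordinate_sphere_def\<close>)
qed

lemma hausdorff_perp_sphere_finite:
  fixes u :: "real ^ 'n"
  assumes "norm u = 1" "0 < a" "CARD('n) \<ge> 2"
  shows "hausdorff (CARD('n) - 2) (perp_sphere u a) < top"
proof -
  fix i :: 'n
  obtain f :: "real ^ 'n \<Rightarrow> real ^ 'n" where f: "orthogonal_transformation f" "f (axis i 1) = u"
    using orthogonal_transformation_exists_1[of "axis i 1" u] assms by auto
  have iso: "dist (f v) (f w) = dist v w" for v w
    using f(1) by (rule dist_orthogonal_transformation)
  have "hausdorff (CARD('n) - 2) (coordinate_sphere i a) < top"
  proof (rule hausdorff_finite_of_coverings[where D = "real CARD('n) ^ 3"])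
    show "0 \<le> 2 * real CARD('n) * (2 * of_int \<lceil>a\<rceil> + 1) ^ (CARD('n) - 2)"
      using assms by (intro mult_nonneg_nonneg zero_le_power) auto
  qed (use coordinate_sphere_covering[OF assms(2,3)] in auto)
  then show ?thesis
    unfolding perp_sphere_eq_image[OF f]
    by (rule le_less_trans[OF hausdorff_isometric_image_le[OF iso]])
qed

text \<open>\<open>P\<close> is merely a witness: any uniformly distributed probability on the
  sphere can play the test measure in the mass distribution principle.\<close>

lemma hausdorff_perp_sphere_pos:
  fixes u :: "real ^ 'n"
  assumes "norm u = 1" "0 < a" "CARD('n) \<ge> 2" and P: "uniformly_distributed (perp_sphere u a) P"
  shows "0 < hausdorff (CARD('n) - 2) (perp_sphere u a)"
proof (rule hausdorff_pos_of_packings[OF P])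
  show "0 < a / real CARD('n)" using assms by simp
  fix m :: nat assume "0 < m"
  fix i :: 'n
  obtain f :: "real ^ 'n \<Rightarrow> real ^ 'n" where f: "orthogonal_transformation f" "f (axis i 1) = u"
    using orthogonal_transformation_exists_1[of "axis i 1" u] assms by auto
  have iso: "dist (f v) (f w) = dist v w" for v w
    using f(1) by (rule dist_orthogonal_transformation)
  obtain F where F: "finite F" "F \<subseteq> coordinate_sphere i a" "card F = m ^ (CARD('n) - 2)"
    "\<forall>y\<in>F. \<forall>z\<in>F. y \<noteq> z \<longrightarrow> a / real CARD('n) / real m \<le> dist y z"
    using coordinate_sphere_packing[OF assms(2,3) \<open>0 < m\<close>, of i] by blast
  have "card (f ` F) = card F"
    by (rule card_image[OF inj_on_subset[OF orthogonal_transformation_inj[OF f(1)] subset_UNIV]])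
  then show "\<exists>F. finite F \<and> F \<subseteq> perp_sphere u a \<and> card F = m ^ (CARD('n) - 2) \<and>
      (\<forall>y\<in>F. \<forall>z\<in>F. y \<noteq> z \<longrightarrow> a / real CARD('n) / real m \<le> dist y z)"
    using F iso unfolding perp_sphere_eq_image[OF f] by (intro exI[of _ "f ` F"]) auto
qed

section \<open>The two ensembles\<close>

definition diag_unit :: "real ^ 'n" where
  "diag_unit = (\<chi> i. 1 / sqrt (real CARD('n)))"

lemma norm_diag_unit: "norm (diag_unit :: real ^ 'n) = 1"
proof -
  have "(norm (diag_unit :: real ^ 'n))\<^sup>2 = 1" by (simp add: norm_squared_vec diag_unit_def power_divide)
  from real_sqrt_unique[OF this norm_ge_zero] show ?thesis by simp
qed

lemma total_spin_eq: "total_spin (\<phi> :: real ^ 'n) = sqrt (real CARD('n)) * (\<phi> \<bullet> diag_unit)"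
  by (simp add: total_spin_def diag_unit_def inner_vec_def sum_divide_distrib[symmetric])

lemma particle_number_eq: "particle_number \<phi> = (norm \<phi>)\<^sup>2"
  by (simp add: particle_number_def norm_squared_vec)

lemma mc_shell_eq:
  assumes "0 \<le> \<rho>"
  shows "mc_shell \<rho> = perp_sphere (diag_unit :: real ^ 'n) (sqrt (\<rho> * real CARD('n)))"
proof -
  have "(norm \<phi>)\<^sup>2 = \<rho> * real CARD('n) \<longleftrightarrow> norm \<phi> = sqrt (\<rho> * real CARD('n))" for \<phi> :: "real ^ 'n"
    using assms by (auto simp: real_sqrt_unique)
  then show ?thesis
    by (auto simp: mc_shell_def perp_sphere_def total_spin_eq particle_number_eq)
qed

text \<open>\<open>measure_of\<close> depends only on values on the generated sigma-algebra, where
  the two set functions agree; countable additivity of the quotient is thus inherited from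
  \<open>uniform_measure\<close>.\<close>

lemma mc_ensemble_eq_uniform_measure:
  assumes "mc_shell \<rho> \<in> sets (borel :: (real ^ 'n) measure)"
  shows "(mc_ensemble \<rho> :: (real ^ 'n) measure) =
    uniform_measure (hausdorff_measure (CARD('n) - 2)) (mc_shell \<rho>)" (is "_ = ?U")
proof -
  have "mc_ensemble \<rho> = measure_of UNIV (sets borel) (emeasure ?U)"
    unfolding mc_ensemble_def
  proof (rule measure_of_eq)
    fix A :: "(real ^ 'n) set" assume "A \<in> sigma_sets UNIV (sets borel)"
    then have "A \<in> sets borel" using sets.sigma_sets_eq[of "borel :: (real ^ 'n) measure"] by simp
    then show "hausdorff (CARD('n) - 2) (A \<inter> mc_shell \<rho>) / hausdorff (CARD('n) - 2) (mc_shell \<rho> :: (real ^ 'n) set)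
        = emeasure ?U A"
      using assms by (simp add: emeasure_hausdorff_measure Int_commute)
  qed simp
  also have "\<dots> = ?U" using measure_of_of_measure[of ?U] by simp
  finally show ?thesis .
qed

lemma gc_weight_eq:
  "gc_weight J \<beta> \<mu> (\<phi> :: real ^ 'n) = exp (\<beta> * J / 2 * (\<phi> \<bullet> diag_unit)\<^sup>2 - \<mu> * (norm \<phi>)\<^sup>2)"
  by (simp add: gc_weight_def mf_hamiltonian_def total_spin_eq particle_number_eq power_mult_distrib)

lemma borel_measurable_gc_weight [measurable]: "gc_weight J \<beta> \<mu> \<in> borel_measurable borel"
  unfolding gc_weight_eq[abs_def] by measurable

text \<open>The weight depends on the configuration only through its norm and its component along
  \<open>diag_unit\<close>, and Lebesgue measure is invariant.\<close>

lemma gc_ensemble_orthogonal_invariant: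
  fixes f :: "real ^ 'n \<Rightarrow> real ^ 'n"
  assumes f: "orthogonal_transformation f" "f diag_unit = diag_unit"
  shows "distr (gc_ensemble J \<beta> \<mu>) borel f = gc_ensemble J \<beta> \<mu>"
proof -
  note [measurable] = borel_measurable_orthogonal_transformation[OF f(1)]
  define Z where "Z = (\<integral>\<psi>. gc_weight J \<beta> \<mu> (\<psi> :: real ^ 'n) \<partial>lborel)"
  have "f x \<bullet> diag_unit = x \<bullet> diag_unit" for x
    using f by (metis orthogonal_transformation_def)
  then have weight: "gc_weight J \<beta> \<mu> (f x) = gc_weight J \<beta> \<mu> x" for x
    by (simp add: gc_weight_eq orthogonal_transformation_norm[OF f(1)])
  have "gc_ensemble J \<beta> \<mu> = density (distr lborel borel f) (\<lambda>\<phi>. ennreal (gc_weight J \<beta> \<mu> \<phi> / Z))"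
    unfolding distr_lborel_orthogonal_transformation[OF f(1)] by (simp add: gc_ensemble_def Z_def)
  also have "\<dots> = distr (density lborel (\<lambda>x. ennreal (gc_weight J \<beta> \<mu> (f x) / Z))) borel f"
    by (rule density_distr) measurable
  also have "\<dots> = distr (gc_ensemble J \<beta> \<mu>) borel f"
    by (simp add: weight gc_ensemble_def Z_def)
  finally show ?thesis by simp
qed

lemma norm_squared_Basis: "(norm (x :: 'a::euclidean_space))\<^sup>2 = (\<Sum>b\<in>Basis. (x \<bullet> b)\<^sup>2)"
  unfolding power2_norm_eq_inner by (subst euclidean_inner) (simp only: power2_eq_square)

text \<open>Rotating \<open>b\<^sub>0\<close> to \<open>diag_unit\<close> diagonalises the quadratic
  form: its coefficient is \<open>\<mu> - \<beta> * J / 2\<close> along \<open>b\<^sub>0\<close> and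
  \<open>\<mu>\<close> in all other directions.\<close>

lemma gc_ensemble_eq_gauss_measure:
  fixes f :: "real ^ 'n \<Rightarrow> real ^ 'n"
  assumes f: "orthogonal_transformation f" "f b\<^sub>0 = diag_unit" and b0: "b\<^sub>0 \<in> Basis"
    and "0 < \<mu>" "0 < \<mu> - \<beta> * J / 2"
    and \<sigma>: "\<sigma> = (\<lambda>b. if b = b\<^sub>0 then sqrt (1 / (2 * (\<mu> - \<beta> * J / 2))) else sqrt (1 / (2 * \<mu>)))"
  shows "gc_ensemble J \<beta> \<mu> = distr (gauss_measure \<sigma>) borel f"
proof -
  note [measurable] = borel_measurable_orthogonal_transformation[OF f(1)]
  let ?w = "gc_weight J \<beta> \<mu>"
  define Z where "Z = (\<integral>\<psi>. ?w (\<psi> :: real ^ 'n) \<partial>lborel)"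
  define c where "c = (\<Prod>b\<in>(Basis :: (real ^ 'n) set). 1 / sqrt (2 * pi * (\<sigma> b)\<^sup>2))"
  have \<sigma>_pos: "0 < \<sigma> b" for b using assms by (simp add: \<sigma>)
  have "0 < 2 * pi * (\<sigma> b)\<^sup>2" for b
    using \<sigma>_pos[of b] by (intro mult_pos_pos zero_less_power) auto
  then have "0 < c" unfolding c_def by (intro prod_pos) simp
  have exponent: "(\<Sum>b\<in>Basis. - (x \<bullet> b)\<^sup>2 / (2 * (\<sigma> b)\<^sup>2)) = \<beta> * J / 2 * (x \<bullet> b\<^sub>0)\<^sup>2 - \<mu> * (norm x)\<^sup>2" for x
  proof -
    have inv: "- y / (2 * (\<sigma> b)\<^sup>2) = (if b = b\<^sub>0 then \<beta> * J / 2 * y else 0) - \<mu> * y" for b y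
      using assms(4,5) by (auto simp: \<sigma> field_simps)
    have "(\<Sum>b\<in>Basis. - (x \<bullet> b)\<^sup>2 / (2 * (\<sigma> b)\<^sup>2))
        = (\<Sum>b\<in>Basis. (if b = b\<^sub>0 then \<beta> * J / 2 * (x \<bullet> b)\<^sup>2 else 0) - \<mu> * (x \<bullet> b)\<^sup>2)"
      by (simp only: inv)
    then show ?thesis
      using b0 by (simp add: norm_squared_Basis[of x] sum_subtractf sum_distrib_left)
  qed
  have inner: "f x \<bullet> diag_unit = x \<bullet> b\<^sub>0" for x using f by (metis orthogonal_transformation_def)
  have dens: "(\<Prod>b\<in>Basis. normal_density 0 (\<sigma> b) (x \<bullet> b)) = c * ?w (f x)" for x
  proof -
    have "(\<Prod>b\<in>Basis. normal_density 0 (\<sigma> b) (x \<bullet> b))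
        = c * (\<Prod>b\<in>Basis. exp (- (x \<bullet> b)\<^sup>2 / (2 * (\<sigma> b)\<^sup>2)))"
      by (simp only: normal_density_def diff_zero prod.distrib c_def)
    also have "(\<Prod>b\<in>Basis. exp (- (x \<bullet> b)\<^sup>2 / (2 * (\<sigma> b)\<^sup>2))) = ?w (f x)"
      by (simp only: exp_sum[OF finite_Basis, symmetric] exponent gc_weight_eq inner
          orthogonal_transformation_norm[OF f(1)])
    finally show ?thesis .
  qed
  have "has_bochner_integral lborel (\<lambda>x. \<Prod>b\<in>Basis. normal_density 0 (\<sigma> b) (x \<bullet> b))
      (\<Prod>b\<in>(Basis :: (real ^ 'n) set). integral\<^sup>L lborel (normal_density 0 (\<sigma> b)))"
    using \<sigma>_pos by (intro has_bochner_integral_lborel_prod) auto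
  then have "has_bochner_integral lborel (\<lambda>x. c * ?w (f x)) 1"
    using \<sigma>_pos by (simp add: dens)
  \<comment> \<open>The Gaussian density has integral 1, which identifies the product
    \<open>c\<close> of Gaussian prefactors with \<open>1 / Z\<close> without evaluating the
    partition function.\<close>
  then have "c * (\<integral>x. ?w (f x) \<partial>lborel) = 1"
    using \<open>0 < c\<close> by (simp add: has_bochner_integral_iff)
  moreover have "(\<integral>x. ?w (f x) \<partial>lborel) = Z"
    unfolding Z_def
    by (subst (2) distr_lborel_orthogonal_transformation[OF f(1), symmetric]) (simp add: integral_distr)
  ultimately have "c * Z = 1" by simp
  then have c: "c = 1 / Z" by (metis eq_divide_eq mult_zero_right zero_neq_one)
  have "gc_ensemble J \<beta> \<mu> = density (distr lborel borel f) (\<lambda>\<phi>. ennreal (?w \<phi> / Z))"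
    unfolding distr_lborel_orthogonal_transformation[OF f(1)] by (simp add: gc_ensemble_def Z_def)
  also have "\<dots> = distr (density lborel (\<lambda>x. ennreal (?w (f x) / Z))) borel f"
    by (rule density_distr) measurable
  also have "density lborel (\<lambda>x. ennreal (?w (f x) / Z)) = gauss_measure \<sigma>"
    by (simp add: gauss_measure_def dens c)
  finally show ?thesis .
qed

text \<open>The law of \<open>(x, T x)\<close> is a coupling, so any transport map bounds the
  infimum by its own cost.\<close>

lemma w2_sq_distr_le:
  fixes P :: "(real ^ 'n) measure"
  assumes "prob_space P" "sets P = sets borel" and T [measurable]: "T \<in> borel_measurable borel"
  shows "w2_sq P (distr P borel T) \<le> (\<integral>\<^sup>+x. ennreal (1 / real CARD('n) * (norm (x - T x))\<^sup>2) \<partial>P)"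
proof -
  interpret prob_space P by fact
  note [measurable_cong] = \<open>sets P = sets borel\<close>
  let ?\<gamma> = "distr P borel (\<lambda>x. (x, T x))"
  have pair [measurable]: "(\<lambda>x. (x, T x)) \<in> measurable P borel"
    by (intro borel_measurable_Pair) (auto simp: measurable_ident_sets assms)
  have fst_snd [measurable]: "fst \<in> borel_measurable (borel :: ((real ^ 'n) \<times> (real ^ 'n)) measure)"
    "snd \<in> borel_measurable (borel :: ((real ^ 'n) \<times> (real ^ 'n)) measure)"
    by (intro borel_measurable_continuous_onI continuous_intros)+
  have "?\<gamma> \<in> couplings P (distr P borel T)"
    unfolding couplings_def
  proof (intro CollectI conjI)
    show "prob_space ?\<gamma>" by (rule prob_space_distr) measurable
    have "distr P borel (\<lambda>x. x) = P" using distr_id2[of borel P] assms by simp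
    then show "distr ?\<gamma> borel fst = P" by (simp add: distr_distr comp_def)
    show "distr ?\<gamma> borel snd = distr P borel T" by (simp add: distr_distr comp_def)
  qed simp
  then have "w2_sq P (distr P borel T) \<le>
      (\<integral>\<^sup>+p. ennreal ((1 / real CARD('n)) * (\<Sum>i\<in>UNIV. \<bar>fst p $ i - snd p $ i\<bar>\<^sup>2)) \<partial>?\<gamma>)"
    unfolding w2_sq_def by (rule INF_lower)
  also have "\<dots> = (\<integral>\<^sup>+p. ennreal (1 / real CARD('n) * (norm (fst p - snd p))\<^sup>2) \<partial>?\<gamma>)"
    by (simp add: norm_squared_vec)
  also have "\<dots> = (\<integral>\<^sup>+x. ennreal (1 / real CARD('n) * (norm (x - T x))\<^sup>2) \<partial>P)"
    by (subst nn_integral_distr) auto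
  finally show ?thesis .
qed

lemma gc_cost_le:
  fixes J \<mu> \<rho> \<beta> :: real
  assumes N: "CARD('n) \<ge> 2" and "\<mu> > 0" and \<rho>: "\<rho> = 1 / (2 * \<mu>)" and pos: "0 < \<mu> - \<beta> * J / 2"
    and a: "a = sqrt (\<rho> * real CARD('n))"
  shows "(\<integral>\<^sup>+\<phi>. ennreal (1 / real CARD('n) * (norm (\<phi> - sphere_projection diag_unit a \<phi>))\<^sup>2)
      \<partial>(gc_ensemble J \<beta> \<mu> :: (real ^ 'n) measure))
    \<le> ennreal (1 / real CARD('n) * (1 / (2 * (\<mu> - \<beta> * J / 2))) + 1 / real CARD('n) * (1 / \<mu>))"
proof -
  let ?N = "real CARD('n)"
  have "0 < \<rho>" using \<open>\<mu> > 0\<close> \<rho> by simp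
  have "0 < a" using \<open>0 < \<rho>\<close> by (simp add: a)
  have a2: "a\<^sup>2 = \<rho> * ?N" using \<open>0 < \<rho>\<close> by (simp add: a)
  fix i :: 'n
  define b\<^sub>0 :: "real ^ 'n" where "b\<^sub>0 = axis i 1"
  have b0: "b\<^sub>0 \<in> Basis" by (simp add: b\<^sub>0_def)
  obtain f :: "real ^ 'n \<Rightarrow> real ^ 'n" where f: "orthogonal_transformation f" "f b\<^sub>0 = diag_unit"
    using orthogonal_transformation_exists_1[of b\<^sub>0 diag_unit] norm_diag_unit by (auto simp: b\<^sub>0_def)
  note [measurable] = borel_measurable_orthogonal_transformation[OF f(1)]
  define \<tau> where "\<tau> = 1 / (2 * (\<mu> - \<beta> * J / 2))"
  define \<sigma> where "\<sigma> = (\<lambda>b. if b = b\<^sub>0 then sqrt \<tau> else sqrt \<rho>)"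
  have "0 < \<tau>" using pos by (simp add: \<tau>_def)
  have \<sigma>_pos: "0 < \<sigma> b" for b using \<open>0 < \<tau>\<close> \<open>0 < \<rho>\<close> by (simp add: \<sigma>_def)
  have gc: "gc_ensemble J \<beta> \<mu> = distr (gauss_measure \<sigma>) borel f"
    unfolding \<sigma>_def \<tau>_def \<rho> by (rule gc_ensemble_eq_gauss_measure[OF f b0 \<open>\<mu> > 0\<close> pos refl])
  define D where "D = Basis - {b\<^sub>0}"
  define g where "g = (\<lambda>z. 1 / ?N * (z \<bullet> b\<^sub>0)\<^sup>2 +
      1 / ?N * (((\<Sum>b\<in>D. (z \<bullet> b)\<^sup>2 - (sqrt \<rho>)\<^sup>2) - \<rho>)\<^sup>2 / a\<^sup>2))"
  have card_D: "real (card D) = ?N - 1"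
    using b0 by (simp add: D_def card_Diff_subset of_nat_diff)
  have pointwise: "1 / ?N * (norm (f z - sphere_projection diag_unit a (f z)))\<^sup>2 \<le> g z" for z
  proof -
    have inner: "f z \<bullet> diag_unit = z \<bullet> b\<^sub>0" using f by (metis orthogonal_transformation_def)
    have "(norm z)\<^sup>2 = (\<Sum>b\<in>Basis. (z \<bullet> b)\<^sup>2)"
      by (rule norm_squared_Basis)
    also have "\<dots> = (z \<bullet> b\<^sub>0)\<^sup>2 + (\<Sum>b\<in>D. (z \<bullet> b)\<^sup>2)"
      unfolding D_def using b0 by (simp add: sum.remove)
    finally have "(norm (perp diag_unit (f z)))\<^sup>2 = (\<Sum>b\<in>D. (z \<bullet> b)\<^sup>2)"
      by (simp add: norm_perp[OF norm_diag_unit] inner orthogonal_transformation_norm[OF f(1)])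
    \<comment> \<open>\<open>D\<close> has \<open>N - 1\<close> elements whereas
      \<open>a\<^sup>2 = \<rho> * N\<close>; the subtracted \<open>\<rho>\<close> makes up for the
      missing coordinate.\<close>
    moreover have "(\<Sum>b\<in>D. (z \<bullet> b)\<^sup>2 - (sqrt \<rho>)\<^sup>2) - \<rho> = (\<Sum>b\<in>D. (z \<bullet> b)\<^sup>2) - a\<^sup>2"
      using \<open>0 < \<rho>\<close> by (simp add: sum_subtractf card_D a2 algebra_simps)
    ultimately show ?thesis
      using mult_left_mono[OF dist_sphere_projection_le[OF norm_diag_unit \<open>0 < a\<close>, of "f z"], of "1 / ?N"]
      by (simp add: g_def inner distrib_left)
  qed
  have "has_bochner_integral (gauss_measure \<sigma>) (\<lambda>z. (z \<bullet> b\<^sub>0)\<^sup>2) \<tau>"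
    using normal_moment_2[OF \<sigma>_pos, of b\<^sub>0] \<sigma>_pos b0 \<open>0 < \<tau>\<close>
    by (intro gauss_measure_coordinate[where p = "\<lambda>y. y\<^sup>2"]) (auto simp: \<sigma>_def)
  moreover have "has_bochner_integral (gauss_measure \<sigma>) (\<lambda>z. ((\<Sum>b\<in>D. (z \<bullet> b)\<^sup>2 - (sqrt \<rho>)\<^sup>2) - \<rho>)\<^sup>2)
      (2 * sqrt \<rho> ^ 4 * real (card D) + \<rho>\<^sup>2)"
    using \<sigma>_pos by (intro gauss_measure_centred_square_sum) (auto simp: D_def \<sigma>_def)
  ultimately have g_int: "has_bochner_integral (gauss_measure \<sigma>) g
      (1 / ?N * \<tau> + 1 / ?N * ((2 * sqrt \<rho> ^ 4 * real (card D) + \<rho>\<^sup>2) / a\<^sup>2))"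
    unfolding g_def
    by (intro has_bochner_integral_add has_bochner_integral_mult_right has_bochner_integral_divide)
  have moments: "(2 * sqrt \<rho> ^ 4 * real (card D) + \<rho>\<^sup>2) / a\<^sup>2 \<le> 1 / \<mu>"
  proof -
    have "sqrt \<rho> ^ 4 = \<rho>\<^sup>2" using \<open>0 < \<rho>\<close> by (simp add: power4_eq_xxxx power2_eq_square)
    then have "(2 * sqrt \<rho> ^ 4 * real (card D) + \<rho>\<^sup>2) / a\<^sup>2 = \<rho>\<^sup>2 * (2 * ?N - 1) / (\<rho> * ?N)"
      by (simp add: card_D a2 algebra_simps)
    \<comment> \<open>Apart from the projection estimate, replacing \<open>2 * N - 1\<close> by
      \<open>2 * N\<close> is the only loss.\<close>
    also have "\<dots> \<le> \<rho>\<^sup>2 * (2 * ?N) / (\<rho> * ?N)"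
      using \<open>0 < \<rho>\<close> by (intro divide_right_mono mult_left_mono) auto
    also have "\<dots> = 2 * \<rho>" using \<open>0 < \<rho>\<close> by (simp add: power2_eq_square)
    also have "\<dots> = 1 / \<mu>" using \<open>\<mu> > 0\<close> by (simp add: \<rho>)
    finally show ?thesis .
  qed
  have "(\<integral>\<^sup>+\<phi>. ennreal (1 / ?N * (norm (\<phi> - sphere_projection diag_unit a \<phi>))\<^sup>2)
      \<partial>(gc_ensemble J \<beta> \<mu> :: (real ^ 'n) measure))
    = (\<integral>\<^sup>+z. ennreal (1 / ?N * (norm (f z - sphere_projection diag_unit a (f z)))\<^sup>2) \<partial>gauss_measure \<sigma>)"
    unfolding gc by (rule nn_integral_distr) measurable
  also have "\<dots> \<le> (\<integral>\<^sup>+z. ennreal (g z) \<partial>gauss_measure \<sigma>)"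
    by (intro nn_integral_mono ennreal_leI pointwise)
  also have "\<dots> = ennreal (1 / ?N * \<tau> + 1 / ?N * ((2 * sqrt \<rho> ^ 4 * real (card D) + \<rho>\<^sup>2) / a\<^sup>2))"
    using g_int by (subst nn_integral_eq_integral) (auto simp: has_bochner_integral_iff g_def)
  also have "\<dots> \<le> ennreal (1 / ?N * \<tau> + 1 / ?N * (1 / \<mu>))"
    using moments by (intro ennreal_leI add_left_mono mult_left_mono) auto
  finally show ?thesis by (simp only: \<tau>_def)
qed

lemma prob_space_gc_ensemble:
  assumes "\<mu> > 0" "0 < \<mu> - \<beta> * J / 2"
  shows "prob_space (gc_ensemble J \<beta> \<mu> :: (real ^ 'n) measure)"
proof -
  fix i :: 'n
  obtain f :: "real ^ 'n \<Rightarrow> real ^ 'n" where f: "orthogonal_transformation f" "f (axis i 1) = diag_unit"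
    using orthogonal_transformation_exists_1[of "axis i 1" diag_unit] norm_diag_unit by auto
  have eq: "gc_ensemble J \<beta> \<mu> = distr (gauss_measure (\<lambda>b. if b = axis i 1
      then sqrt (1 / (2 * (\<mu> - \<beta> * J / 2))) else sqrt (1 / (2 * \<mu>)))) borel f"
    by (rule gc_ensemble_eq_gauss_measure[OF f _ assms refl]) simp
  show ?thesis
    unfolding eq using assms borel_measurable_orthogonal_transformation[OF f(1)]
    by (intro prob_space.prob_space_distr prob_space_gauss_measure) auto
qed

text \<open>From two sites on the shell is non-empty; with a single site only 0 has vanishing sum,
  and its norm is wrong. For positive \<open>J\<close> the condition on \<open>\<beta>\<close> says
  that the Gaussian along the constant direction is normalisable.\<close>

theorem theorem4p21:
  fixes J \<mu> \<rho> \<beta> :: real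
  assumes "CARD('n) \<ge> 2"
    and "J > 0" and "\<mu> > 0" and "\<rho> = 1 / (2 * \<mu>)" and "\<beta> < 2 * \<mu> / J"
  shows "w2_sq (gc_ensemble J \<beta> \<mu> :: (real ^ 'n) measure) (mc_ensemble \<rho>)
           \<le> ennreal (1 / real CARD('n) * (1 / (2 * (\<mu> - \<beta> * J / 2))) + 1 / real CARD('n) * (1 / \<mu>))
       \<and> 1 / real CARD('n) * (1 / (2 * (\<mu> - \<beta> * J / 2))) + 1 / real CARD('n) * (1 / \<mu>)
           = 1 / real CARD('n) * (\<rho> / (1 - \<rho> * \<beta> * J) + 2 * \<rho>)"
proof
  let ?GC = "gc_ensemble J \<beta> \<mu> :: (real ^ 'n) measure" and ?u = "diag_unit :: real ^ 'n"
  define a where "a = sqrt (\<rho> * real CARD('n))"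
  have pos: "0 < \<mu> - \<beta> * J / 2" using assms by (simp add: field_simps)
  have "0 < \<rho>" using assms by simp
  then have "0 < a" by (simp add: a_def)
  have shell: "mc_shell \<rho> = perp_sphere ?u a" using \<open>0 < \<rho>\<close> by (simp add: mc_shell_eq a_def)
  have sets: "sets ?GC = sets borel" by (simp add: gc_ensemble_def)
  have "AE x in ?GC. perp ?u x \<noteq> 0"
    unfolding gc_ensemble_def
    by (subst AE_density) (use AE_lborel_perp_nonzero[of ?u] assms in auto)
  then have proj: "uniformly_distributed (perp_sphere ?u a) (distr ?GC borel (sphere_projection ?u a))"
    using assms pos sets \<open>0 < a\<close>
    by (intro uniformly_distributed_sphere_projection prob_space_gc_ensemble norm_diag_unit
        gc_ensemble_orthogonal_invariant) auto
  have "uniformly_distributed (perp_sphere ?u a) (mc_ensemble \<rho>)"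
  proof -
    have "perp_sphere ?u a \<in> sets borel" unfolding perp_sphere_def by measurable
    then have "mc_ensemble \<rho> = uniform_measure (hausdorff_measure (CARD('n) - 2)) (perp_sphere ?u a)"
      using mc_ensemble_eq_uniform_measure[of \<rho>, where 'n='n] by (simp add: shell)
    then show ?thesis
      using uniformly_distributed_hausdorff
        hausdorff_perp_sphere_pos[OF norm_diag_unit \<open>0 < a\<close> assms(1) proj]
        hausdorff_perp_sphere_finite[OF norm_diag_unit \<open>0 < a\<close> assms(1)] by simp
  qed
  then have mc: "mc_ensemble \<rho> = distr ?GC borel (sphere_projection ?u a)"
    using proj by (rule uniformly_distributed_unique)
  have "w2_sq ?GC (mc_ensemble \<rho>)
      \<le> (\<integral>\<^sup>+\<phi>. ennreal (1 / real CARD('n) * (norm (\<phi> - sphere_projection ?u a \<phi>))\<^sup>2) \<partial>?GC)"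
    unfolding mc using assms pos sets by (intro w2_sq_distr_le prob_space_gc_ensemble) auto
  also have "\<dots> \<le> ennreal (1 / real CARD('n) * (1 / (2 * (\<mu> - \<beta> * J / 2))) + 1 / real CARD('n) * (1 / \<mu>))"
    by (rule gc_cost_le[OF assms(1,3,4) pos a_def])
  finally show "w2_sq ?GC (mc_ensemble \<rho>) \<le> \<dots>" .
  show "1 / real CARD('n) * (1 / (2 * (\<mu> - \<beta> * J / 2))) + 1 / real CARD('n) * (1 / \<mu>)
      = 1 / real CARD('n) * (\<rho> / (1 - \<rho> * \<beta> * J) + 2 * \<rho>)"
  proof -
    \<comment> \<open>Since \<open>2 * \<rho> * \<mu> = 1\<close>, both denominators are the same
      quantity up to the factor \<open>2 * \<rho>\<close>.\<close>
    have "1 - \<rho> * \<beta> * J = 2 * \<rho> * (\<mu> - \<beta> * J / 2)" using assms(3,4) by (simp add: field_simps)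
    then have "\<rho> / (1 - \<rho> * \<beta> * J) = 1 / (2 * (\<mu> - \<beta> * J / 2))"
      using \<open>0 < \<rho>\<close> by simp
    moreover have "2 * \<rho> = 1 / \<mu>" using assms(4) by simp
    ultimately show ?thesis by (simp only: distrib_left)
  qed
qed

end
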